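(* Let $\mathfrak{F}\subseteq\mathfrak{F}_{\mathrm{all}}$ satisfy $\mathfrak{F}\supseteq\mathfrak{F}_{\mathrm{AR}(2)}^{ext}$ and suppose that the polynomial trend assumption holds: $X=(F,\tilde X)$, where $F$ is $n\times k_F$-dimensional ($1\le k_F\le k$) with $j$-th column $(1^{j-1},\ldots,n^{j-1})'$, where $\tilde X$ is an $n\times(k-k_F)$-dimensional matrix such that $X$ has rank $k$ ($\tilde X$ is the empty matrix if $k_F=k$), and the restriction matrix $R$ has a nonzero column $R_{\cdot i}$ for some $i\in\{1,\ldots,k_F\}$. Suppose further that $N_{\mathrm{AM}}\ne\mathbb{R}^n$. Then $\check\beta=\hat\beta$ and $\check\Omega=\check\Omega_{\mathcal{W}_{\mathrm{AM}}}$ satisfy the estimator conditions with $N=N_{\mathrm{AM}}$. Let $T$ be the nonsphericity-corrected F-type test statistic with $\check\beta=\hat\beta$, $\check\Omega=\check\Omega_{\mathcal{W}_{\mathrm{AM}}}$, and $N=N_{\mathrm{AM}}$. Then $$\sup_{f\in\mathfrak{F}}P_{\mu_0,\sigma^2\Sigma(f)}(T\ge C)=1$$ holds for every critical value $C$, $-\infty<C<\infty$, for every $\mu_0\in\mathfrak{M}_0$, and for every $\sigma^2\in(0,\infty)$.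
   Context: Model: $n,k,q$ are positive integers with $1\le k<n$; $X\in\mathbb{R}^{n\times k}$ is a fixed matrix of rank $k$; $R\in\mathbb{R}^{q\times k}$ has rank $q\ge 1$; $r\in\mathbb{R}^q$. (One tests $R\beta=r$ in $\mathbf{Y}=X\beta+\mathbf{U}$, $\mathbf{U}\sim N(0,\sigma^2\Sigma(f))$, $0<\sigma^2<\infty$, $f\in\mathfrak{F}$.) $'$ is transpose, $\mathfrak{M}_0=\{X\beta:R\beta=r\}$, $\hat\beta(y)=(X'X)^{-1}X'y$, $\hat u(y)=y-X\hat\beta(y)$ with coordinates $\hat u_i(y)$. $P_{\mu,A}$ is the Gaussian measure on $\mathbb{R}^n$ with mean $\mu$ and covariance $A$; $P(T\ge C)$ means $P(\{y:T(y)\ge C\})$. $\lambda_{\mathbb{R}^n}$ is Lebesgue measure. Spectral densities: $\mathfrak{F}_{\mathrm{all}}$ is the set of all normalized spectral densities of real weakly stationary processes (nonnegative, even, integrable $f$ on $[-\pi,\pi]$ with $\int_{-\pi}^{\pi}f=1$); $\mathfrak{F}_{\mathrm{AR}(2)}$ is the subset of those corresponding to stationary autoregressive processes of order at most two; $\mathfrak{F}_{\mathrm{AR}(2)}^{ext}$ is the set of all $c_1f+(2\pi)^{-1}c_2$ with $f\in\mathfrak{F}_{\mathrm{AR}(2)}$, $c_1,c_2\ge0$, $c_1+c_2=1$; $\Sigma(f)=\left[\int_{-\pi}^{\pi}e^{-\iota(j-l)\omega}f(\omega)d\omega\right]_{j,l=1}^n$, $\iota$ the imaginary unit. AR(1)-prewhitened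 estimator: let $\hat\rho(y)=\sum_{i=2}^n\hat u_i(y)\hat u_{i-1}(y)/\sum_{i=1}^{n-1}\hat u_i^2(y)$; $\hat v_i(y)=\hat u_{i+1}(y)-\hat\rho(y)\hat u_i(y)$, $i=1,\ldots,n-1$, written as $\hat v(y)=\mathsf{A}(\hat\rho(y))\hat u(y)$ where $\mathsf{A}(\rho)\in\mathbb{R}^{(n-1)\times n}$ has $(i,i)$ entry $-\rho$, $(i,i+1)$ entry $1$, other entries $0$; $\tilde\rho(y)=\sum_{i=2}^{n-1}\hat v_i(y)\hat v_{i-1}(y)/\sum_{i=1}^{n-2}\hat v_i^2(y)$; $M_{\mathrm{AM}}(y)=1.3221\left(n\,\frac{4\tilde\rho^2(y)}{(1-\tilde\rho(y))^4}\right)^{1/5}$; $$\mathcal{W}_{\mathrm{AM}}(y)=(1-\hat\rho(y))^{-2}\mathsf{A}'(\hat\rho(y))\left[\kappa_{\mathrm{QS}}(|i-j|/M_{\mathrm{AM}}(y))\right]_{i,j=1}^{n-1}\mathsf{A}(\hat\rho(y)),$$ where the bracketed matrix is $I_{n-1}$ if $M_{\mathrm{AM}}(y)=0$, and $\kappa_{\mathrm{QS}}$ is the Quadratic-Spectral kernel $\kappa_{\mathrm{QS}}(x)=\frac{25}{12\pi^2x^2}\left(\frac{\sin(6\pi x/5)}{6\pi x/5}-\cos(6\pi x/5)\right)$ for $x\ne0$, $\kappa_{\mathrm{QS}}(0)=1$. Set $\hat\omega_{\mathcal{W}_{\mathrm{AM}}}(y)=n^{-1}\hat u'(y)\mathcal{W}_{\mathrm{AM}}(y)\hat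 u(y)$ and $\check\Omega_{\mathcal{W}_{\mathrm{AM}}}(y)=\hat\omega_{\mathcal{W}_{\mathrm{AM}}}(y)R(X'X)^{-1}R'$. These are well-defined exactly on the set of $y\in\mathbb{R}^n$ for which $\hat\rho(y)$ and $\tilde\rho(y)$ are both well-defined and not equal to $1$, i.e. on $$\left\{y:\sum_{i=1}^{n-1}\hat u_i(y)(\hat u_{i+1}(y)-\hat u_i(y))\ne0,\ \sum_{i=1}^{n-2}\hat v_i(y)(\hat v_{i+1}(y)-\hat v_i(y))\ne0\right\};$$ $N_{\mathrm{AM}}$ is the complement of this set in $\mathbb{R}^n$. Estimator conditions on $(\check\beta,\check\Omega,N)$: (i) $\check\beta:\mathbb{R}^n\setminus N\to\mathbb{R}^k$ and $\check\Omega:\mathbb{R}^n\setminus N\to\mathbb{R}^{q\times q}$ are well-defined and continuous on $\mathbb{R}^n\setminus N$, where $N$ is a closed $\lambda_{\mathbb{R}^n}$-null set, and $\check\Omega(y)$ is symmetric for every $y\in\mathbb{R}^n\setminus N$; (ii) $y\in\mathbb{R}^n\setminus N$ implies $\delta y+X\eta\in\mathbb{R}^n\setminus N$ for all $\delta\ne0$, $\eta\in\mathbb{R}^k$; (iii) $\check\beta(\delta y+X\eta)=\delta\check\beta(y)+\eta$ and $\check\Omega(\delta y+X\eta)=\delta^2\check\Omega(y)$ for all $y\in\mathbb{R}^n\setminus N$, $\delta\neq0$, $\eta\in\mathbb{R}^k$; (iv) $\check\Omega$ is $\lambda_{\mathbb{R}^n}$-almost everywhere nonsingular on $\mathbb{R}^n\setminus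 N$. Nonsphericity-corrected F-type test statistic: with $N^*=N\cup\{y\in\mathbb{R}^n\setminus N:\det\check\Omega(y)=0\}$, $T(y)=(R\check\beta(y)-r)'\check\Omega^{-1}(y)(R\check\beta(y)-r)$ for $y\in\mathbb{R}^n\setminus N^*$ and $T(y)=0$ for $y\in N^*$. *)

theory Defs
  imports "HOL-Probability.Probability"
begin

text \<open>
  Vectors in R^n are elements of \<open>real^'n\<close> with \<open>'n\<close> a finite linearly ordered type; \<open>pos i\<close> is
  the 1-based rank of the index \<open>i\<close>, so that \<open>pos\<close> is a bijection onto \<open>{1..CARD('n)}\<close>.
  \<open>coord y m\<close> is the \<open>m\<close>-th coordinate of \<open>y\<close> and is meaningful for \<open>1 \<le> m \<le> n\<close> only.
\<close>

definition pos :: "'a::{finite,linorder} \<Rightarrow> nat" where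
  "pos i = card {..i}"

definition coord :: "real^'n::{finite,linorder} \<Rightarrow> nat \<Rightarrow> real" where
  "coord y m = y $ (inv pos m)"

text \<open>
  Functions on \<open>[-pi, pi]\<close> are encoded as extensional functions, so that two densities are equal
  iff they agree on \<open>[-pi, pi]\<close>.
\<close>

definition spec_all :: "(real \<Rightarrow> real) set" where
  "spec_all = {f \<in> {-pi..pi} \<rightarrow>\<^sub>E {0..}.
     (\<forall>\<omega>\<in>{-pi..pi}. f (-\<omega>) = f \<omega>) \<and>
     set_integrable lebesgue {-pi..pi} f \<and>
     (LINT \<omega>:{-pi..pi}|lebesgue. f \<omega>) = 1}"

text \<open>
  \<open>y\<^sub>t = a1 * y\<^sub>t\<^sub>-\<^sub>1 + a2 * y\<^sub>t\<^sub>-\<^sub>2 + e\<^sub>t\<close> with white noise \<open>e\<close> of variance \<open>s > 0\<close>. The roots of the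
  autoregressive polynomial are required to lie outside the closed unit disc. Merely excluding
  roots on the unit circle would give the same set of spectral densities. Orders 0 and 1 are
  covered by \<open>a2 = 0\<close>.
\<close>

definition spec_AR2 :: "(real \<Rightarrow> real) set" where
  "spec_AR2 = {f \<in> spec_all. \<exists>(a1::real) (a2::real) (s::real). s > 0 \<and>
     (\<forall>z::complex. cmod z \<le> 1 \<longrightarrow> 1 - of_real a1 * z - of_real a2 * z^2 \<noteq> 0) \<and>
     (\<forall>\<omega>\<in>{-pi..pi}. f \<omega> =
        s / (2 * pi) / (cmod (1 - of_real a1 * cis (-\<omega>) - of_real a2 * cis (-2 * \<omega>)))^2)}"

definition spec_AR2_ext :: "(real \<Rightarrow> real) set" where
  "spec_AR2_ext = {restrict (\<lambda>\<omega>. c1 * f \<omega> + c2 / (2 * pi)) {-pi..pi} | c1 f c2.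
     f \<in> spec_AR2 \<and> c1 \<ge> 0 \<and> c2 \<ge> 0 \<and> c1 + c2 = 1}"

text \<open>
  The integral below is real because \<open>f\<close> is even; \<open>Re\<close> only serves to change the type.
\<close>

definition Sigma_mat :: "(real \<Rightarrow> real) \<Rightarrow> real^'n::{finite,linorder}^'n::{finite,linorder}" where
  "Sigma_mat f = (\<chi> j l. Re (LINT \<omega>:{-pi..pi}|lebesgue.
      exp (- \<i> * of_real ((real (pos j) - real (pos l)) * \<omega>)) * of_real (f \<omega>)))"

definition std_gaussian :: "(real^'n) measure" where
  "std_gaussian = density lborel (\<lambda>z. ennreal (\<Prod>i\<in>UNIV. std_normal_density (z $ i)))"

text \<open>
  The law of \<open>\<mu> + B Z\<close> with \<open>Z\<close> standard normal and \<open>B B' = A\<close>. It does not depend on the choice of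
  \<open>B\<close>, and such a \<open>B\<close> exists for every symmetric nonnegative definite \<open>A\<close>.
\<close>

definition gaussian :: "real^'n \<Rightarrow> real^'n^'n \<Rightarrow> (real^'n) measure" where
  "gaussian \<mu> A =
     distr std_gaussian borel (\<lambda>z. \<mu> + (SOME B :: real^'n^'n. B ** transpose B = A) *v z)"

definition M0 :: "real^'k^'n \<Rightarrow> real^'k^'q \<Rightarrow> real^'q \<Rightarrow> (real^'n) set" where
  "M0 X R r = {X *v \<beta> | \<beta>. R *v \<beta> = r}"

definition beta_hat :: "real^'k^'n \<Rightarrow> real^'n \<Rightarrow> real^'k" where
  "beta_hat X y = (matrix_inv (transpose X ** X) ** transpose X) *v y"

definition u_hat :: "real^'k^'n \<Rightarrow> real^'n \<Rightarrow> real^'n" where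
  "u_hat X y = y - X *v beta_hat X y"

abbreviation u_co :: "real^'k^'n::{finite,linorder} \<Rightarrow> real^'n::{finite,linorder} \<Rightarrow> nat \<Rightarrow> real" where
  "u_co X y i \<equiv> coord (u_hat X y) i"

definition rho_hat :: "real^'k^'n::{finite,linorder} \<Rightarrow> real^'n::{finite,linorder} \<Rightarrow> real" where
  "rho_hat X y = (\<Sum>i=2..CARD('n). u_co X y i * u_co X y (i - 1))
               / (\<Sum>i=1..CARD('n) - 1. (u_co X y i)^2)"

definition v_hat :: "real^'k^'n::{finite,linorder} \<Rightarrow> real^'n::{finite,linorder} \<Rightarrow> nat \<Rightarrow> real" where
  "v_hat X y i = u_co X y (i + 1) - rho_hat X y * u_co X y i"

definition rho_tilde :: "real^'k^'n::{finite,linorder} \<Rightarrow> real^'n::{finite,linorder} \<Rightarrow> real" where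
  "rho_tilde X y = (\<Sum>i=2..CARD('n) - 1. v_hat X y i * v_hat X y (i - 1))
                 / (\<Sum>i=1..CARD('n) - 2. (v_hat X y i)^2)"

definition M_AM :: "real^'k^'n::{finite,linorder} \<Rightarrow> real^'n::{finite,linorder} \<Rightarrow> real" where
  "M_AM X y = 1.3221 *
     (real CARD('n) * (4 * (rho_tilde X y)^2 / (1 - rho_tilde X y)^4)) powr (1 / 5)"

definition kappa_QS :: "real \<Rightarrow> real" where
  "kappa_QS x = (if x = 0 then 1
     else 25 / (12 * pi^2 * x^2) * (sin (6 * pi * x / 5) / (6 * pi * x / 5) - cos (6 * pi * x / 5)))"

text \<open>
  The \<open>(n-1) \<times> n\<close> matrix \<open>A(\<rho>)\<close> and the \<open>(n-1) \<times> (n-1)\<close> kernel matrix have no index type of their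
  own, so their dimension \<open>n-1\<close> is indexed by \<open>{1..n-1}\<close>.
\<close>

definition A_entry :: "real \<Rightarrow> nat \<Rightarrow> 'n::{finite,linorder} \<Rightarrow> real" where
  "A_entry \<rho> i s = (if pos s = i then - \<rho> else if pos s = i + 1 then 1 else 0)"

definition K_entry :: "real \<Rightarrow> nat \<Rightarrow> nat \<Rightarrow> real" where
  "K_entry M i j = (if M = 0 then (if i = j then 1 else 0)
                    else kappa_QS (\<bar>real i - real j\<bar> / M))"

definition W_AM :: "real^'k^'n::{finite,linorder} \<Rightarrow> real^'n::{finite,linorder} \<Rightarrow> real^'n::{finite,linorder}^'n::{finite,linorder}" where
  "W_AM X y = (\<chi> s t. 1 / (1 - rho_hat X y)^2 *
     (\<Sum>i=1..CARD('n) - 1. \<Sum>j=1..CARD('n) - 1.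
        A_entry (rho_hat X y) i s * K_entry (M_AM X y) i j * A_entry (rho_hat X y) j t))"

definition omega_AM :: "real^'k^'n::{finite,linorder} \<Rightarrow> real^'n::{finite,linorder} \<Rightarrow> real" where
  "omega_AM X y = (u_hat X y \<bullet> (W_AM X y *v u_hat X y)) / real CARD('n)"

definition Omega_AM ::
    "real^'k^'n::{finite,linorder} \<Rightarrow> real^'k^'q \<Rightarrow> real^'n::{finite,linorder} \<Rightarrow> real^'q^'q" where
  "Omega_AM X R y =
     omega_AM X y *\<^sub>R (R ** matrix_inv (transpose X ** X) ** transpose R)"

definition N_AM :: "real^'k^'n::{finite,linorder} \<Rightarrow> (real^'n::{finite,linorder}) set" where
  "N_AM X = - {y.
     (\<Sum>i=1..CARD('n) - 1. u_co X y i * (u_co X y (i + 1) - u_co X y i)) \<noteq> 0 \<and>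
     (\<Sum>i=1..CARD('n) - 2. v_hat X y i * (v_hat X y (i + 1) - v_hat X y i)) \<noteq> 0}"

text \<open>
  Since division is total in HOL, well-definedness of the estimator at \<open>y\<close>, i.e. that no division
  by zero occurs in its construction, is made explicit.
\<close>

definition AM_well_defined :: "real^'k^'n::{finite,linorder} \<Rightarrow> real^'n::{finite,linorder} \<Rightarrow> bool" where
  "AM_well_defined X y \<longleftrightarrow>
     (\<Sum>i=1..CARD('n) - 1. (u_co X y i)^2) \<noteq> 0 \<and> rho_hat X y \<noteq> 1 \<and>
     (\<Sum>i=1..CARD('n) - 2. (v_hat X y i)^2) \<noteq> 0 \<and> rho_tilde X y \<noteq> 1"

definition estimator_conditions ::
    "real^'k^'n \<Rightarrow> (real^'n \<Rightarrow> real^'k) \<Rightarrow> (real^'n \<Rightarrow> real^'q^'q) \<Rightarrow> (real^'n) set \<Rightarrow> bool" where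
  "estimator_conditions X \<beta> \<Omega> N \<longleftrightarrow>
     continuous_on (- N) \<beta> \<and> continuous_on (- N) \<Omega> \<and>
     closed N \<and> N \<in> null_sets lborel \<and>
     (\<forall>y. y \<notin> N \<longrightarrow> transpose (\<Omega> y) = \<Omega> y) \<and>
     (\<forall>y \<delta> \<eta>. y \<notin> N \<longrightarrow> \<delta> \<noteq> 0 \<longrightarrow> \<delta> *\<^sub>R y + X *v \<eta> \<notin> N) \<and>
     (\<forall>y \<delta> \<eta>. y \<notin> N \<longrightarrow> \<delta> \<noteq> 0 \<longrightarrow>
        \<beta> (\<delta> *\<^sub>R y + X *v \<eta>) = \<delta> *\<^sub>R \<beta> y + \<eta> \<and>
        \<Omega> (\<delta> *\<^sub>R y + X *v \<eta>) = \<delta>^2 *\<^sub>R \<Omega> y) \<and>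
     (AE y in lborel. y \<notin> N \<longrightarrow> invertible (\<Omega> y))"

definition N_star :: "(real^'n \<Rightarrow> real^'q^'q) \<Rightarrow> (real^'n) set \<Rightarrow> (real^'n) set" where
  "N_star \<Omega> N = N \<union> {y. y \<notin> N \<and> det (\<Omega> y) = 0}"

definition F_type_statistic ::
    "real^'k^'q \<Rightarrow> real^'q \<Rightarrow> (real^'n \<Rightarrow> real^'k) \<Rightarrow> (real^'n \<Rightarrow> real^'q^'q) \<Rightarrow>
     (real^'n) set \<Rightarrow> real^'n \<Rightarrow> real" where
  "F_type_statistic R r \<beta> \<Omega> N y =
     (if y \<in> N_star \<Omega> N then 0
      else (R *v \<beta> y - r) \<bullet> (matrix_inv (\<Omega> y) *v (R *v \<beta> y - r)))"

end

theory Submission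
  imports Defs "HOL-Real_Asymp.Real_Asymp"
begin

text \<open>
  Along AR(2) spectra whose poles approach \<open>exp (\<plusminus> \<i> \<nu>)\<close> the covariance matrix tends to the singular
  matrix with entries \<open>cos ((j - l) \<nu>)\<close>. As \<open>\<nu>\<close> tends to 0, Taylor expansion shows that the column space
  of the latter is within \<open>O(\<nu> ^ kF)\<close> of the polynomial trends, so the residuals see only
  \<open>O(\<nu> ^ (2 kF))\<close> of it, whereas a restriction that involves a trend coefficient sees at
  least a multiple of \<open>\<nu> ^ (2 kF - 2)\<close>. Mixing in white noise with weight \<open>\<nu> ^ (2 kF - 1)\<close> keeps the
  rescaled residuals nondegenerate, so that the variance estimator stays of the order of the weight
  while the numerator of the statistic is of larger order.
\<close>

text \<open>No limit of the statistic itself can be taken: the limiting laws live where the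
  residuals vanish to leading order, and vectors without residual belong to \<open>N_AM\<close>,
  where the statistic is 0 by convention. What rescues the argument is equivariance. The variance
  estimator sees only the residuals and is homogeneous of degree two, so the residuals may be
  magnified until their covariance tends to the residual projection. \<open>N_AM\<close> is the zero
  set of a polynomial and invariant under shifts along the column space of \<open>X\<close>, hence a
  single point outside it already keeps the magnified limit outside almost surely. There
  \<open>omega_AM\<close> is continuous and strictly positive, by strict positive definiteness of
  the kernel matrix.

  A pole approaching frequency 0 directly would leave only the constant vector in the limiting
  covariance. Keeping \<nu> positive and expanding in it brings in every power of the time index, so
  that a restriction on any trend coefficient is reached. This requires two nested limits: the pole
  radius is fixed after \<nu> and the noise weight, with an error bound uniform in \<nu>.\<close>

declare transpose_matrix_vector [simp del]

section \<open>Ranks of indices and coordinates\<close>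

lemma pos_less_iff: "pos i < pos j \<longleftrightarrow> i < (j::'a::{finite,linorder})"
proof -
  have mono: "pos i < pos j" if "i < j" for i j :: 'a
    unfolding pos_def using that by (intro psubset_card_mono) auto
  show ?thesis
    using mono[of i j] mono[of j i] by (metis less_asym less_irrefl neqE)
qed

lemma bij_betw_pos: "bij_betw (pos :: 'a::{finite,linorder} \<Rightarrow> nat) UNIV {1..CARD('a)}"
proof -
  have inj: "inj (pos :: 'a \<Rightarrow> nat)"
    by (rule injI) (metis less_irrefl neqE pos_less_iff)
  have "pos i \<in> {1..CARD('a)}" for i :: 'a
    unfolding pos_def by (auto simp: Suc_le_eq card_gt_0_iff intro!: card_mono)
  then have "range (pos :: 'a \<Rightarrow> nat) \<subseteq> {1..CARD('a)}" by auto
  moreover have "card (range (pos :: 'a \<Rightarrow> nat)) = CARD('a)"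
    using inj by (simp add: card_image)
  ultimately have "range (pos :: 'a \<Rightarrow> nat) = {1..CARD('a)}"
    by (intro card_subset_eq) auto
  with inj show ?thesis by (simp add: bij_betw_def)
qed

lemma pos_eq_iff [simp]: "pos i = pos j \<longleftrightarrow> i = (j::'a::{finite,linorder})"
  using bij_betw_pos by (metis UNIV_I bij_betw_def inj_on_def)

lemma pos_ge_1: "1 \<le> pos i"
  using bij_betw_pos by (metis UNIV_I atLeastAtMost_iff bij_betwE)

lemma coord_pos [simp]: "coord y (pos i) = y $ (i::'a::{finite,linorder})"
proof -
  have "inj (pos :: 'a \<Rightarrow> nat)"
    using bij_betw_pos by (auto simp: bij_betw_def)
  then show ?thesis by (simp add: coord_def)
qed

lemma sum_pos:
  "(\<Sum>i\<in>UNIV. g (pos (i::'a::{finite,linorder}))) = sum g {1..CARD('a)}"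
  by (rule sum.reindex_bij_betw[OF bij_betw_pos])

lemma ex_pos:
  assumes "1 \<le> m" "m \<le> CARD('a::{finite,linorder})"
  shows "\<exists>i::'a. pos i = m"
  using bij_betw_pos[where 'a='a] assms by (metis atLeastAtMost_iff bij_betw_iff_bijections)

lemma coord_add: "coord (x + y) i = coord x i + coord y i"
  and coord_scaleR: "coord (c *\<^sub>R x) i = c * coord x i"
  by (simp_all add: coord_def)

lemma linear_coord: "linear (\<lambda>y. coord y i)"
  by (auto intro!: linearI simp: coord_add coord_scaleR)


section \<open>Least squares\<close>

definition gram :: "real^'k^'n \<Rightarrow> real^'k^'k" where
  "gram X = transpose X ** X"

lemma transpose_gram [simp]: "transpose (gram X) = gram X"
  by (simp add: gram_def matrix_transpose_mul)

lemma inner_gram: "v \<bullet> (gram X *v v) = (X *v v) \<bullet> (X *v v)"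
  by (metis dot_lmul_matrix gram_def matrix_vector_mul_assoc inner_commute
      vector_transpose_matrix)

lemma invertible_gram:
  fixes X :: "real^'k^'n"
  assumes "rank X = CARD('k)"
  shows "invertible (gram X)"
proof -
  have inj: "inj ((*v) X)"
    using assms full_rank_injective by blast
  have "v = 0" if "gram X *v v = 0" for v
  proof -
    have "(X *v v) \<bullet> (X *v v) = 0"
      using that by (metis inner_gram inner_zero_right)
    then have "X *v v = X *v 0" by simp
    then show ?thesis using inj by (meson injD)
  qed
  then have "inj ((*v) (gram X))"
    by (metis linear_injective_0 matrix_vector_mul_linear)
  then show ?thesis
    by (metis invertible_left_inverse matrix_left_invertible_injective)
qed

lemma
  fixes A :: "real^'n^'n"
  assumes "invertible A"
  shows matrix_inv_right: "A ** matrix_inv A = mat 1" and matrix_inv_left: "matrix_inv A ** A = mat 1"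
  using someI_ex[OF assms[unfolded invertible_def]] by (simp_all add: matrix_inv_def)

lemma matrix_inv_eqI:
  fixes A :: "real^'n^'n"
  assumes "A ** B = mat 1" "B ** A = mat 1"
  shows "matrix_inv A = B"
proof -
  have "invertible A" using assms invertible_def by blast
  then show ?thesis
    by (metis assms(1) matrix_inv_left matrix_mul_assoc matrix_mul_lid matrix_mul_rid)
qed

lemma transpose_matrix_inv:
  fixes A :: "real^'n^'n"
  assumes "invertible A"
  shows "transpose (matrix_inv A) = matrix_inv (transpose A)"
proof -
  have "matrix_inv A ** A = mat 1" "A ** matrix_inv A = mat 1"
    using assms matrix_inv_left matrix_inv_right by blast+
  then have "transpose A ** transpose (matrix_inv A) = mat 1"
    "transpose (matrix_inv A) ** transpose A = mat 1"
    by (metis matrix_transpose_mul transpose_mat)+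
  then show ?thesis
    by (metis matrix_inv_eqI)
qed

lemma beta_hat_eq: "beta_hat X y = matrix_inv (gram X) *v (transpose X *v y)"
  by (simp add: beta_hat_def gram_def matrix_vector_mul_assoc)

lemma beta_hat_fitted [simp]:
  fixes X :: "real^'k^'n"
  assumes "rank X = CARD('k)"
  shows "beta_hat X (X *v \<eta>) = \<eta>"
proof -
  have "matrix_inv (gram X) ** gram X = mat 1"
    by (intro matrix_inv_left invertible_gram assms)
  then show ?thesis
    by (simp add: beta_hat_eq matrix_vector_mul_assoc gram_def matrix_mul_assoc)
qed

lemma linear_beta_hat: "linear (beta_hat X)"
proof -
  have "beta_hat X = (*v) (matrix_inv (transpose X ** X) ** transpose X)"
    by (simp add: beta_hat_def fun_eq_iff)
  then show ?thesis by simp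
qed

lemma linear_u_hat: "linear (u_hat X)"
  unfolding u_hat_def
  by (intro linear_compose_sub linear_ident linear_compose[OF linear_beta_hat, unfolded o_def])
    simp_all

lemma u_hat_fitted [simp]:
  fixes X :: "real^'k^'n"
  assumes "rank X = CARD('k)"
  shows "u_hat X (X *v \<eta>) = 0"
  using assms by (simp add: u_hat_def)

lemma u_hat_affine:
  fixes X :: "real^'k^'n"
  assumes "rank X = CARD('k)"
  shows "u_hat X (\<delta> *\<^sub>R y + X *v \<eta>) = \<delta> *\<^sub>R u_hat X y"
  using assms linear_u_hat[of X] by (simp add: linear_add linear_cmul)

text \<open>For \<open>X\<close> of full column rank this is the orthogonal projection onto the
  complement of the column space. The matrix form is needed to sandwich covariance matrices.\<close>

definition residual_maker :: "real^'k^'n \<Rightarrow> real^'n^'n" where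
  "residual_maker X = mat 1 - X ** matrix_inv (gram X) ** transpose X"

lemma u_hat_eq: "u_hat X y = residual_maker X *v y"
  by (simp add: u_hat_def beta_hat_eq residual_maker_def matrix_vector_mult_diff_rdistrib
      matrix_vector_mul_assoc matrix_mul_assoc)

lemma residual_maker_fitted:
  fixes X :: "real^'k^'n"
  assumes "rank X = CARD('k)"
  shows "residual_maker X *v (X *v \<eta>) = 0"
  using assms by (simp flip: u_hat_eq)

lemma transpose_minus_matrix: "transpose (A - B) = transpose A - transpose (B::real^'n^'m)"
  by (simp add: transpose_def vec_eq_iff)

lemma transpose_residual_maker:
  fixes X :: "real^'k^'n"
  assumes "rank X = CARD('k)"
  shows "transpose (residual_maker X) = residual_maker X"
  using transpose_matrix_inv[OF invertible_gram[OF assms]]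
  by (simp add: residual_maker_def transpose_minus_matrix matrix_transpose_mul matrix_mul_assoc)

lemma residual_maker_idem:
  fixes X :: "real^'k^'n"
  assumes "rank X = CARD('k)"
  shows "residual_maker X ** residual_maker X = residual_maker X"
proof -
  have "residual_maker X *v (residual_maker X *v y) = residual_maker X *v y" for y
  proof -
    have "residual_maker X *v y = y - X *v beta_hat X y"
      by (simp add: u_hat_def flip: u_hat_eq)
    then show ?thesis
      using residual_maker_fitted[OF assms] by (simp add: matrix_vector_mult_diff_distrib)
  qed
  then show ?thesis
    by (metis matrix_eq matrix_vector_mul_assoc)
qed

text \<open>Writing \<open>w = gram X *v v\<close> turns the form into the squared length of
  \<open>X *v v\<close>.\<close>

lemma inner_matrix_inv_gram_pos:
  fixes X :: "real^'k^'n"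
  assumes "rank X = CARD('k)" "w \<noteq> 0"
  shows "w \<bullet> (matrix_inv (gram X) *v w) > 0"
proof -
  have inv: "gram X ** matrix_inv (gram X) = mat 1"
    by (intro matrix_inv_right invertible_gram assms(1))
  define v where "v = matrix_inv (gram X) *v w"
  have w: "w = gram X *v v"
    by (simp add: v_def matrix_vector_mul_assoc inv)
  have "X *v v \<noteq> 0"
  proof
    assume "X *v v = 0"
    then have "gram X *v v = 0"
      by (simp add: gram_def flip: matrix_vector_mul_assoc)
    with w assms(2) show False by simp
  qed
  then have "(X *v v) \<bullet> (X *v v) > 0" by simp
  then show ?thesis
    using w by (metis inner_commute inner_gram v_def)
qed

text \<open>The covariance matrix of \<open>R *v beta_hat X y\<close> under white noise of unit
  variance; it is the factor of \<open>Omega_AM\<close> that does not depend on the data.\<close>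

definition restriction_cov :: "real^'k^'n \<Rightarrow> real^'k^'q \<Rightarrow> real^'q^'q" where
  "restriction_cov X R = R ** matrix_inv (gram X) ** transpose R"

lemma inner_matrix_vector_transpose: "x \<bullet> (A *v y) = (transpose A *v x) \<bullet> (y::real^'n)"
  by (metis dot_lmul_matrix vector_transpose_matrix transpose_transpose)

lemma restriction_cov_pos:
  fixes X :: "real^'k^'n" and R :: "real^'k^'q"
  assumes "rank X = CARD('k)" "rank R = CARD('q)" "x \<noteq> 0"
  shows "x \<bullet> (restriction_cov X R *v x) > 0"
proof -
  have "inj ((*v) (transpose R))"
    using assms(2) full_rank_injective[of "transpose R"] by (simp add: rank_transpose)
  then have "transpose R *v x \<noteq> 0"
    using assms(3) by (metis injD matrix_vector_mult_0_right)
  then have "(transpose R *v x) \<bullet> (matrix_inv (gram X) *v (transpose R *v x)) > 0"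
    by (rule inner_matrix_inv_gram_pos[OF assms(1)])
  then show ?thesis
    by (simp add: restriction_cov_def inner_matrix_vector_transpose[of x]
        flip: matrix_vector_mul_assoc)
qed

lemma transpose_restriction_cov:
  fixes X :: "real^'k^'n"
  assumes "rank X = CARD('k)"
  shows "transpose (restriction_cov X R) = restriction_cov X R"
  using transpose_matrix_inv[OF invertible_gram[OF assms]]
  by (simp add: restriction_cov_def matrix_transpose_mul matrix_mul_assoc)

section \<open>Positive definite matrices\<close>

lemma invertible_if_definite:
  fixes A :: "real^'n^'n"
  assumes "\<And>x. x \<noteq> 0 \<Longrightarrow> x \<bullet> (A *v x) > 0"
  shows "invertible A"
proof -
  have "x = 0" if "A *v x = 0" for x
    using assms[of x] that by fastforce
  then have "inj ((*v) A)"
    by (metis linear_injective_0 matrix_vector_mul_linear)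
  then show ?thesis
    by (metis invertible_left_inverse matrix_left_invertible_injective)
qed

text \<open>The Cauchy-Schwarz inequality for the inner product given by \<open>S\<close>. It
  reduces the q-dimensional statistic to a scalar one in a freely chosen direction
  \<open>l\<close>.\<close>

lemma inner_matrix_inv_ge:
  fixes S :: "real^'q^'q"
  assumes sym: "transpose S = S" and pos: "\<And>x. x \<noteq> 0 \<Longrightarrow> x \<bullet> (S *v x) > 0" and "l \<noteq> 0"
  shows "(l \<bullet> w)\<^sup>2 / (l \<bullet> (S *v l)) \<le> w \<bullet> (matrix_inv S *v w)"
proof -
  have inv: "S ** matrix_inv S = mat 1"
    by (intro matrix_inv_right invertible_if_definite pos)
  define v where "v = matrix_inv S *v w"
  have w: "w = S *v v"
    by (simp add: v_def matrix_vector_mul_assoc inv)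
  define a where "a = l \<bullet> (S *v l)"
  \<comment> \<open>This value minimizes the quadratic form of \<open>S\<close> at
    \<open>v - c *\<^sub>R l\<close>.\<close>
  define c where "c = (l \<bullet> w) / a"
  have a: "a > 0" using pos[OF \<open>l \<noteq> 0\<close>] by (simp add: a_def)
  have sym': "l \<bullet> (S *v v) = v \<bullet> (S *v l)"
    using inner_matrix_vector_transpose[of l S v] sym by (simp add: inner_commute)
  have "0 \<le> (v - c *\<^sub>R l) \<bullet> (S *v (v - c *\<^sub>R l))"
    using pos[of "v - c *\<^sub>R l"] by (cases "v - c *\<^sub>R l = 0") auto
  also have "\<dots> = v \<bullet> w - 2 * c * (l \<bullet> w) + c\<^sup>2 * a"
    using sym' by (simp add: w a_def inner_diff_left inner_diff_right power2_eq_square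
        matrix_vector_mult_diff_distrib matrix_vector_mult_scaleR algebra_simps)
  also have "\<dots> = v \<bullet> w - (l \<bullet> w)\<^sup>2 / a"
    using a by (simp add: c_def field_simps power2_eq_square)
  finally show ?thesis
    by (simp add: v_def a_def inner_commute)
qed


section \<open>Zero sets of polynomial functions\<close>

lemma finite_zeros_real_polynomial_function:
  fixes p :: "real \<Rightarrow> real"
  assumes "real_polynomial_function p" "p a \<noteq> 0"
  shows "finite {t. p t = 0}"
proof -
  obtain c n where p: "p = (\<lambda>x. \<Sum>i\<le>n. c i * x ^ i)"
    using assms(1) real_polynomial_function_iff_sum by blast
  from assms(2) have "\<exists>i\<le>n. c i \<noteq> 0"
    by (metis (no_types, lifting) atMost_iff mult_zero_left p sum.neutral)
  then obtain k where "k \<le> n" "c k \<noteq> 0" by blast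
  then show ?thesis
    unfolding p using polyfun_finite_roots[of c n] by blast
qed

lemma AE_affine_lborel:
  fixes y0 :: "'a::euclidean_space"
  assumes "c \<noteq> 0" "AE z in lborel. P (y0 + c *\<^sub>R z)" and [measurable]: "Measurable.pred borel P"
  shows "AE y in lborel. P y"
proof -
  have "AE y in distr lborel borel (\<lambda>z. y0 + c *\<^sub>R z). P y"
    using assms(2) by (subst AE_distr_iff) auto
  then show ?thesis
    by (subst lborel_affine[OF \<open>c \<noteq> 0\<close>, of y0]) (auto simp: AE_density)
qed

text \<open>
  Along every line through a point where the polynomial does not vanish there are only finitely
  many zeros; Fubini turns this into a statement about almost all dilations of the zero set.
\<close>

lemma AE_real_polynomial_function_nonzero:
  fixes q :: "'a::euclidean_space \<Rightarrow> real"
  assumes poly: "real_polynomial_function q" and "q y0 \<noteq> 0"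
  shows "AE y in lborel. q y \<noteq> 0"
proof -
  have cont: "continuous_on UNIV q"
    using poly continuous_on_polymonial_function real_polynomial_function_eq
    by blast
  have [measurable]: "q \<in> borel_measurable borel"
    using cont by (rule borel_measurable_continuous_onI)
  have line: "AE t in lborel. q (y0 + t *\<^sub>R z) \<noteq> 0" for z
  proof -
    have "polynomial_function (\<lambda>t::real. y0 + t *\<^sub>R z)"
      by (intro polynomial_function_add polynomial_function_const
          polynomial_function_bounded_linear bounded_linear_scaleR_left)
    then have "real_polynomial_function (\<lambda>t. q (y0 + t *\<^sub>R z))"
      using poly by (rule real_polynomial_function_compose[unfolded o_def])
    then have "finite {t. q (y0 + t *\<^sub>R z) = 0}"
      using assms(2) by (intro finite_zeros_real_polynomial_function[where a=0]) auto
    then have "{t. q (y0 + t *\<^sub>R z) = 0} \<in> null_sets lborel"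
      by (rule finite_imp_null_set_lborel)
    then show ?thesis using AE_not_in by fastforce
  qed
  have "AE t in lborel. AE z in lborel. q (y0 + t *\<^sub>R z) \<noteq> 0"
  proof (subst lborel_pair.AE_commute)
    show "{x \<in> space (lborel \<Otimes>\<^sub>M lborel). q (y0 + fst x *\<^sub>R snd x) \<noteq> 0} \<in> sets (lborel \<Otimes>\<^sub>M lborel)"
      by measurable
  qed (use line in simp)
  \<comment> \<open>One dilation factor is enough to transfer the conclusion back, but it has to be
    nonzero for the dilation to preserve null sets.\<close>
  moreover have "AE t::real in lborel. t \<noteq> 0"
    by (rule AE_I[where N="{0}"]) auto
  ultimately have *: "AE t in lborel. t \<noteq> 0 \<and> (AE z in lborel. q (y0 + t *\<^sub>R z) \<noteq> 0)"
    by eventually_elim auto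
  have "\<exists>t. t \<noteq> 0 \<and> (AE z in lborel. q (y0 + t *\<^sub>R z) \<noteq> 0)"
  proof (rule ccontr)
    assume "\<not> ?thesis"
    with * have "AE t::real in lborel. False" by auto
    then show False by (simp add: AE_iff_null null_sets_def)
  qed
  then obtain t where "t \<noteq> 0" "AE z in lborel. q (y0 + t *\<^sub>R z) \<noteq> 0" by blast
  then show ?thesis
    by (rule AE_affine_lborel) measurable
qed


section \<open>The exceptional set\<close>

lemma sum_lagged_differences:
  fixes a :: "nat \<Rightarrow> real"
  shows "(\<Sum>i=1..m. a i * (a (i + 1) - a i)) =
    (\<Sum>i=2..Suc m. a i * a (i - 1)) - (\<Sum>i=1..m. (a i)\<^sup>2)"
proof -
  have "(\<Sum>i=2..Suc m. a i * a (i - 1)) = (\<Sum>i=1..m. a (Suc i) * a i)"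
    using sum.shift_bounds_cl_Suc_ivl[of "\<lambda>i. a i * a (i - 1)" 1 m] by (simp add: numeral_2_eq_2)
  then show ?thesis
    by (simp add: sum_subtractf[symmetric] right_diff_distrib power2_eq_square mult.commute)
qed

text \<open>The sum on the right is the numerator minus the denominator of the quotient. This links
  the sums in \<open>N_AM\<close> to the conditions that \<open>rho_hat\<close> and
  \<open>rho_tilde\<close> differ from 1.\<close>

lemma lagged_ratio_eq_1_iff:
  fixes a :: "nat \<Rightarrow> real"
  assumes "(\<Sum>i=1..m. (a i)\<^sup>2) \<noteq> 0"
  shows "(\<Sum>i=2..Suc m. a i * a (i - 1)) / (\<Sum>i=1..m. (a i)\<^sup>2) = 1 \<longleftrightarrow>
    (\<Sum>i=1..m. a i * (a (i + 1) - a i)) = 0"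
  using assms unfolding sum_lagged_differences by (auto simp del: sum.cl_ivl_Suc)

text \<open>Hence the two inequations defining \<open>N_AM\<close> also keep the denominators of
  \<open>rho_hat\<close> and \<open>rho_tilde\<close> away from 0.\<close>

lemma sum_squares_nonzero:
  fixes a :: "nat \<Rightarrow> real"
  assumes "(\<Sum>i=1..m. a i * b i) \<noteq> 0"
  shows "(\<Sum>i=1..m. (a i)\<^sup>2) \<noteq> 0"
proof
  assume "(\<Sum>i=1..m. (a i)\<^sup>2) = 0"
  then have "\<forall>i\<in>{1..m}. (a i)\<^sup>2 = 0"
    by (subst (asm) sum_nonneg_eq_0_iff) auto
  then have "(\<Sum>i=1..m. a i * b i) = 0" by (intro sum.neutral) auto
  with assms show False by contradiction
qed

context
  fixes X :: "real^'k^'n::{finite,linorder}"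
begin

definition u_lag :: "real^'n::{finite,linorder} \<Rightarrow> real" where
  "u_lag y = (\<Sum>i=1..CARD('n) - 1. u_co X y i * (u_co X y (i + 1) - u_co X y i))"

definition v_lag :: "real^'n::{finite,linorder} \<Rightarrow> real" where
  "v_lag y = (\<Sum>i=1..CARD('n) - 2. v_hat X y i * (v_hat X y (i + 1) - v_hat X y i))"

lemma not_in_N_AM_iff: "y \<notin> N_AM X \<longleftrightarrow> u_lag y \<noteq> 0 \<and> v_lag y \<noteq> 0"
  by (simp add: N_AM_def u_lag_def v_lag_def)

definition u_ssq :: "real^'n::{finite,linorder} \<Rightarrow> real" where
  "u_ssq y = (\<Sum>i=1..CARD('n) - 1. (u_co X y i)\<^sup>2)"

definition v_ssq :: "real^'n::{finite,linorder} \<Rightarrow> real" where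
  "v_ssq y = (\<Sum>i=1..CARD('n) - 2. (v_hat X y i)\<^sup>2)"

lemma u_ssq_nonzero: "u_lag y \<noteq> 0 \<Longrightarrow> u_ssq y \<noteq> 0"
  unfolding u_lag_def u_ssq_def by (rule sum_squares_nonzero)

lemma v_ssq_nonzero: "v_lag y \<noteq> 0 \<Longrightarrow> v_ssq y \<noteq> 0"
  unfolding v_lag_def v_ssq_def by (rule sum_squares_nonzero)

lemma rho_hat_eq_1_iff: "u_ssq y \<noteq> 0 \<Longrightarrow> rho_hat X y = 1 \<longleftrightarrow> u_lag y = 0"
  using lagged_ratio_eq_1_iff[of "u_co X y" "CARD('n) - 1"]
  by (simp add: u_ssq_def rho_hat_def u_lag_def)

lemma rho_tilde_eq_1_iff:
  assumes "2 \<le> CARD('n)" "v_ssq y \<noteq> 0"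
  shows "rho_tilde X y = 1 \<longleftrightarrow> v_lag y = 0"
proof -
  have "Suc (CARD('n) - 2) = CARD('n) - 1" using assms(1) by simp
  with assms(2) show ?thesis
    using lagged_ratio_eq_1_iff[of "v_hat X y" "CARD('n) - 2"]
    unfolding v_ssq_def rho_tilde_def v_lag_def by presburger
qed

lemma AM_well_defined_if_not_in_N_AM:
  assumes "2 \<le> CARD('n)" "y \<notin> N_AM X"
  shows "AM_well_defined X y"
  using assms u_ssq_nonzero v_ssq_nonzero rho_hat_eq_1_iff rho_tilde_eq_1_iff
  unfolding not_in_N_AM_iff AM_well_defined_def u_ssq_def[symmetric] v_ssq_def[symmetric]
  by blast

text \<open>
  \<open>AM_poly\<close> is \<open>u_lag * u_ssq\<^sup>2 * v_lag\<close> with the denominator of \<open>rho_hat\<close> cancelled.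
\<close>

definition v_cleared :: "real^'n::{finite,linorder} \<Rightarrow> nat \<Rightarrow> real" where
  "v_cleared y i = u_ssq y * u_co X y (i + 1) -
     (\<Sum>j=2..CARD('n). u_co X y j * u_co X y (j - 1)) * u_co X y i"

definition AM_poly :: "real^'n::{finite,linorder} \<Rightarrow> real" where
  "AM_poly y = u_lag y *
     (\<Sum>i=1..CARD('n) - 2. v_cleared y i * (v_cleared y (i + 1) - v_cleared y i))"

text \<open>Both closedness and the null set property follow from this form. The factor
  \<open>u_lag\<close> settles the points where \<open>rho_hat\<close> has denominator 0; elsewhere
  clearing that denominator only multiplies \<open>v_lag\<close> by a nonzero square.\<close>

lemma N_AM_eq: "N_AM X = {y. AM_poly y = 0}"
proof -
  have "y \<notin> N_AM X \<longleftrightarrow> AM_poly y \<noteq> 0" for y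
  proof (cases "u_lag y = 0")
    case False
    then have D: "u_ssq y \<noteq> 0" by (rule u_ssq_nonzero)
    have "v_cleared y i = u_ssq y * v_hat X y i" for i
      using D by (simp add: v_cleared_def v_hat_def rho_hat_def right_diff_distrib u_ssq_def)
    then have "(\<Sum>i=1..CARD('n) - 2. v_cleared y i * (v_cleared y (i + 1) - v_cleared y i))
        = (u_ssq y)\<^sup>2 * v_lag y"
      by (simp add: v_lag_def sum_distrib_left power2_eq_square algebra_simps)
    then show ?thesis
      using D by (simp add: AM_poly_def not_in_N_AM_iff)
  qed (simp add: AM_poly_def not_in_N_AM_iff)
  then show ?thesis by auto
qed

lemma linear_u_co: "linear (\<lambda>y. u_co X y i)"
  using linear_compose[OF linear_u_hat linear_coord] by (simp add: o_def)

lemma continuous_on_u_co [continuous_intros]: "continuous_on S (\<lambda>y. u_co X y i)"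
  using linear_u_co by (simp add: linear_continuous_on linear_conv_bounded_linear)

lemma real_polynomial_function_AM_poly: "real_polynomial_function AM_poly"
proof -
  have u: "real_polynomial_function (\<lambda>y. u_co X y i)" for i
    using linear_u_co by (auto intro: real_polynomial_function.intros(1) simp: linear_conv_bounded_linear)
  have D: "real_polynomial_function u_ssq"
    unfolding u_ssq_def[abs_def] by (intro real_polynomial_function_sum real_polynomial_function_power u) auto
  have v: "real_polynomial_function (\<lambda>y. v_cleared y i)" for i
    unfolding v_cleared_def
    by (intro real_polynomial_function_diff real_polynomial_function_sum
        real_polynomial_function.intros(4) u D) auto
  show ?thesis
    unfolding AM_poly_def[abs_def] u_lag_def
    by (intro real_polynomial_function.intros(4) real_polynomial_function_sum
        real_polynomial_function_diff u v) auto
qed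

lemma continuous_on_AM_poly: "continuous_on S AM_poly"
  using continuous_on_polymonial_function real_polynomial_function_AM_poly
    real_polynomial_function_eq continuous_on_subset by blast

lemma closed_N_AM: "closed (N_AM X)"
  unfolding N_AM_eq using continuous_on_AM_poly
  by (intro closed_Collect_eq) auto

lemma AE_not_in_N_AM:
  assumes "N_AM X \<noteq> UNIV"
  shows "AE y in lborel. y \<notin> N_AM X"
proof -
  obtain y0 where "AM_poly y0 \<noteq> 0" using assms by (auto simp: N_AM_eq)
  then show ?thesis
    using AE_real_polynomial_function_nonzero[OF real_polynomial_function_AM_poly] by (simp add: N_AM_eq)
qed

lemma N_AM_null_sets:
  assumes "N_AM X \<noteq> UNIV"
  shows "N_AM X \<in> null_sets lborel"
  using AE_not_in_N_AM[OF assms] closed_N_AM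
  by (simp add: AE_iff_null_sets borel_closed)


subsection \<open>Equivariance\<close>

context
  assumes rank: "rank X = CARD('k)"
begin

lemma u_co_affine: "u_co X (\<delta> *\<^sub>R y + X *v \<eta>) i = \<delta> * u_co X y i"
  using rank by (simp add: u_hat_affine coord_scaleR)

lemma u_ssq_affine: "u_ssq (\<delta> *\<^sub>R y + X *v \<eta>) = \<delta>\<^sup>2 * u_ssq y"
  by (simp add: u_ssq_def u_co_affine power_mult_distrib sum_distrib_left)

lemma rho_hat_affine:
  assumes "\<delta> \<noteq> 0"
  shows "rho_hat X (\<delta> *\<^sub>R y + X *v \<eta>) = rho_hat X y"
proof -
  have "(\<Sum>i=2..CARD('n). (\<delta> * u_co X y i) * (\<delta> * u_co X y (i - 1))) =
      \<delta>\<^sup>2 * (\<Sum>i=2..CARD('n). u_co X y i * u_co X y (i - 1))"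
    by (simp add: sum_distrib_left power2_eq_square algebra_simps)
  then show ?thesis
    using assms u_ssq_affine[of \<delta> y \<eta>] by (simp add: rho_hat_def u_co_affine u_ssq_def)
qed

lemma v_hat_affine: "\<delta> \<noteq> 0 \<Longrightarrow> v_hat X (\<delta> *\<^sub>R y + X *v \<eta>) i = \<delta> * v_hat X y i"
  unfolding v_hat_def by (simp add: rho_hat_affine u_co_affine right_diff_distrib)

lemma rho_tilde_affine:
  assumes "\<delta> \<noteq> 0"
  shows "rho_tilde X (\<delta> *\<^sub>R y + X *v \<eta>) = rho_tilde X y"
proof -
  have "(\<Sum>i=2..CARD('n) - 1. (\<delta> * v_hat X y i) * (\<delta> * v_hat X y (i - 1))) =
      \<delta>\<^sup>2 * (\<Sum>i=2..CARD('n) - 1. v_hat X y i * v_hat X y (i - 1))"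
    "(\<Sum>i=1..CARD('n) - 2. (\<delta> * v_hat X y i)\<^sup>2) = \<delta>\<^sup>2 * (\<Sum>i=1..CARD('n) - 2. (v_hat X y i)\<^sup>2)"
    by (simp_all add: sum_distrib_left power2_eq_square algebra_simps)
  then show ?thesis
    using assms by (simp add: rho_tilde_def v_hat_affine)
qed

lemma not_in_N_AM_affine:
  assumes "\<delta> \<noteq> 0"
  shows "\<delta> *\<^sub>R y + X *v \<eta> \<notin> N_AM X \<longleftrightarrow> y \<notin> N_AM X"
proof -
  have "u_lag (\<delta> *\<^sub>R y + X *v \<eta>) = \<delta>\<^sup>2 * u_lag y"
    unfolding u_lag_def u_co_affine by (simp add: sum_distrib_left power2_eq_square algebra_simps)
  moreover have "v_lag (\<delta> *\<^sub>R y + X *v \<eta>) = \<delta>\<^sup>2 * v_lag y"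
    unfolding v_lag_def v_hat_affine[OF assms]
    by (simp add: sum_distrib_left power2_eq_square algebra_simps)
  ultimately show ?thesis
    using assms by (simp add: not_in_N_AM_iff)
qed

text \<open>Prewhitening coefficient and bandwidth are unchanged by the transformation, so the
  weight matrix is too, and only the two residual vectors around it scale.\<close>

lemma omega_AM_affine:
  assumes "\<delta> \<noteq> 0"
  shows "omega_AM X (\<delta> *\<^sub>R y + X *v \<eta>) = \<delta>\<^sup>2 * omega_AM X y"
proof -
  have "W_AM X (\<delta> *\<^sub>R y + X *v \<eta>) = W_AM X y"
    using assms by (simp add: W_AM_def M_AM_def rho_hat_affine rho_tilde_affine)
  then show ?thesis
    using rank by (simp add: omega_AM_def u_hat_affine matrix_vector_mult_scaleR power2_eq_square)
qed

end

end


section \<open>The Quadratic-Spectral kernel\<close>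

text \<open>Exhibits the kernel as the Fourier transform of a parabola that is nonnegative on
  \<open>{-1..1}\<close>; \<open>4 / 3\<close> is the total mass of the parabola.\<close>

lemma has_integral_kappa_QS:
  "((\<lambda>s. (1 - s\<^sup>2) * cos (6 * pi * x / 5 * s)) has_integral 4 / 3 * kappa_QS x) {-1..1}"
proof (cases "x = 0")
  case True
  have "((\<lambda>s::real. 1 - s\<^sup>2) has_integral (1 - 1 ^ 3 / 3) - (- 1 - (- 1) ^ 3 / 3)) {-1..1}"
    by (rule fundamental_theorem_of_calculus)
      (auto intro!: derivative_eq_intros simp flip: has_real_derivative_iff_has_vector_derivative
        simp: power2_eq_square)
  then show ?thesis using True by (simp add: kappa_QS_def)
next
  case False
  define c where "c = 6 * pi * x / 5"
  have c: "c \<noteq> 0" using False by (simp add: c_def)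
  \<comment> \<open>The antiderivative found by integrating by parts twice.\<close>
  define F where "F s = (1 - s\<^sup>2) * sin (c * s) / c - 2 * s * cos (c * s) / c\<^sup>2 + 2 * sin (c * s) / c ^ 3"
    for s
  have "((\<lambda>s. (1 - s\<^sup>2) * cos (c * s)) has_integral F 1 - F (-1)) {-1..1}"
  proof (rule fundamental_theorem_of_calculus)
    fix s
    have "(F has_real_derivative (1 - s\<^sup>2) * cos (c * s)) (at s within {-1..1})"
      unfolding F_def using c
      by (auto intro!: derivative_eq_intros simp: field_simps power2_eq_square power3_eq_cube)
    then show "(F has_vector_derivative (1 - s\<^sup>2) * cos (c * s)) (at s within {-1..1})"
      by (simp add: has_real_derivative_iff_has_vector_derivative)
  qed simp
  also have "F 1 - F (-1) = 4 / 3 * (3 / c\<^sup>2 * (sin c / c - cos c))"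
    using c by (simp add: F_def field_simps power2_eq_square power3_eq_cube)
  also have "3 / c\<^sup>2 * (sin c / c - cos c) = kappa_QS x"
    using False by (simp add: kappa_QS_def c_def power2_eq_square)
  finally show ?thesis unfolding c_def .
qed

text \<open>\<open>cos (p i - p j)\<close> is the real part of
  \<open>cis (p i) * cnj (cis (p j))\<close>. This is the common source of positivity for the kernel
  matrix and for the covariance matrices.\<close>

lemma sum_cos_differences:
  fixes a :: "'i \<Rightarrow> real" and p :: "'i \<Rightarrow> real"
  shows "(\<Sum>i\<in>I. \<Sum>j\<in>I. a i * cos (p i - p j) * a j) =
    (cmod (\<Sum>i\<in>I. of_real (a i) * cis (p i)))\<^sup>2"
proof -
  have "(cmod (\<Sum>i\<in>I. of_real (a i) * cis (p i)))\<^sup>2 =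
      (\<Sum>i\<in>I. a i * cos (p i))\<^sup>2 + (\<Sum>i\<in>I. a i * sin (p i))\<^sup>2"
    by (simp add: cmod_power2)
  then show ?thesis
    by (simp add: cos_diff power2_eq_square sum_product sum.distrib[symmetric] algebra_simps)
qed

text \<open>
  The kernel is the Fourier transform of a nonnegative density on an interval, so a null vector
  would give a polynomial with infinitely many zeros on the unit circle.
\<close>

lemma K_entry_positive_definite:
  fixes a :: "nat \<Rightarrow> real"
  assumes "0 \<le> M" "k \<in> {1..m}" "a k \<noteq> 0"
  shows "(\<Sum>i=1..m. \<Sum>j=1..m. a i * K_entry M i j * a j) > 0"
proof (cases "M = 0")
  case True
  have "(\<Sum>i=1..m. \<Sum>j=1..m. a i * K_entry M i j * a j) = (\<Sum>i=1..m. (a i)\<^sup>2)"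
    using True by (simp add: K_entry_def power2_eq_square if_distrib if_distribR cong: if_cong)
  also have "\<dots> > 0"
    using assms by (intro sum_pos2[where i=k]) auto
  finally show ?thesis .
next
  case False
  \<comment> \<open>The frequency in the integral representation of the kernel at argument
    \<open>1 / M\<close>; a lag \<open>i - j\<close> multiplies it.\<close>
  define \<theta> where "\<theta> = 6 * pi / (5 * M)"
  have \<theta>: "\<theta> > 0" using False assms(1) by (simp add: \<theta>_def)
  define g where "g s = (cmod (\<Sum>i=1..m. of_real (a i) * cis (real i * \<theta> * s)))\<^sup>2" for s
  define Q where "Q = (\<Sum>i=1..m. \<Sum>j=1..m. a i * K_entry M i j * a j)"
  have K: "((\<lambda>s. (1 - s\<^sup>2) * cos (real i * \<theta> * s - real j * \<theta> * s)) has_integral 4 / 3 * K_entry M i j)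
      {-1..1}" for i j
  proof -
    have "cos (6 * pi * (\<bar>real i - real j\<bar> / M) / 5 * s) = cos (\<bar>real i - real j\<bar> * (\<theta> * s))" for s
      using False by (simp add: \<theta>_def field_simps)
    also have "cos (\<bar>real i - real j\<bar> * (\<theta> * s)) = cos (real i * \<theta> * s - real j * \<theta> * s)" for s
    proof -
      have "real i * \<theta> * s - real j * \<theta> * s = (real i - real j) * (\<theta> * s)"
        by (simp add: algebra_simps)
      then show ?thesis by (simp only:) (auto simp: abs_if simp del: minus_diff_eq simp flip: minus_mult_left)
    qed
    finally show ?thesis
      using has_integral_kappa_QS[of "\<bar>real i - real j\<bar> / M"] False by (simp add: K_entry_def)
  qed
  have "((\<lambda>s. \<Sum>i=1..m. \<Sum>j=1..m. a i * ((1 - s\<^sup>2) * cos (real i * \<theta> * s - real j * \<theta> * s)) * a j)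
      has_integral (\<Sum>i=1..m. \<Sum>j=1..m. a i * (4 / 3 * K_entry M i j) * a j)) {-1..1}"
    by (intro has_integral_sum has_integral_mult_left has_integral_mult_right K) auto
  moreover have "(\<Sum>i=1..m. \<Sum>j=1..m. a i * ((1 - s\<^sup>2) * cos (real i * \<theta> * s - real j * \<theta> * s)) * a j)
      = (1 - s\<^sup>2) * g s" for s
    unfolding g_def sum_cos_differences[symmetric] by (simp add: sum_distrib_left algebra_simps)
  moreover have "(\<Sum>i=1..m. \<Sum>j=1..m. a i * (4 / 3 * K_entry M i j) * a j) = 4 / 3 * Q"
    by (simp add: Q_def sum_distrib_left algebra_simps)
  ultimately have int: "((\<lambda>s. (1 - s\<^sup>2) * g s) has_integral 4 / 3 * Q) {-1..1}"
    by (simp only:)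
  have nonneg: "(1 - s\<^sup>2) * g s \<ge> 0" if "s \<in> {-1..1}" for s
    using that by (auto simp: g_def abs_square_le_1 intro!: mult_nonneg_nonneg)
  have "0 \<le> 4 / 3 * Q"
    using has_integral_nonneg[OF int] nonneg by simp
  moreover have "Q \<noteq> 0"
  proof
    assume "Q = 0"
    have cont: "continuous_on {-1..1} (\<lambda>s. (1 - s\<^sup>2) * g s)"
      unfolding g_def cis_conv_exp by (intro continuous_intros)
    have zero: "(1 - s\<^sup>2) * g s = 0" if "s \<in> {-1..1}" for s
      using has_integral_0_cbox_imp_0[of "-1" 1 "\<lambda>s. (1 - s\<^sup>2) * g s" s] cont nonneg int \<open>Q = 0\<close> that
      by simp
    \<comment> \<open>The sums start at 1 while polynomials start at degree 0, so the constant
      coefficient is set to 0.\<close>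
    define c where "c i = (if i \<in> {1..m} then complex_of_real (a i) else 0)" for i
    have root: "(\<Sum>i\<le>m. c i * cis (\<theta> * s) ^ i) = 0" if "s \<in> {0<..<1}" for s
    proof -
      have "s\<^sup>2 < 1" using that by (simp add: abs_square_less_1)
      then have "g s = 0" using zero[of s] that by auto
      then have "(\<Sum>i=1..m. of_real (a i) * cis (real i * \<theta> * s)) = 0" by (simp add: g_def)
      moreover have "(\<Sum>i\<le>m. c i * cis (\<theta> * s) ^ i) = (\<Sum>i=1..m. c i * cis (\<theta> * s) ^ i)"
        by (rule sum.mono_neutral_right) (auto simp: c_def)
      moreover have "\<dots> = (\<Sum>i=1..m. of_real (a i) * cis (real i * \<theta> * s))"
        by (rule sum.cong) (auto simp: c_def Complex.DeMoivre mult.assoc)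
      ultimately show ?thesis by simp
    qed
    \<comment> \<open>On this range \<open>\<theta> * s\<close> stays below 1, hence below pi, so
      \<open>Arg\<close> recovers it and the points on the circle are distinct.\<close>
    define \<delta> where "\<delta> = min 1 (1 / \<theta>)"
    have \<delta>: "0 < \<delta>" "\<delta> \<le> 1" "\<delta> \<le> 1 / \<theta>" using \<theta> by (auto simp: \<delta>_def)
    have "inj_on (\<lambda>s. cis (\<theta> * s)) {0<..<\<delta>}"
    proof (rule inj_on_inverseI)
      fix s assume "s \<in> {0<..<\<delta>}"
      then have "0 < \<theta> * s" "\<theta> * s < \<theta> * \<delta>" "\<theta> * \<delta> \<le> 1"
        using \<theta> \<delta> by (auto simp: field_simps)
      then have "Arg (cis (\<theta> * s)) = \<theta> * s"
        using pi_gt3 by (intro cis_Arg_unique) (auto simp: sgn_eq)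
      then show "Arg (cis (\<theta> * s)) / \<theta> = s" using \<theta> by simp
    qed
    then have "infinite ((\<lambda>s. cis (\<theta> * s)) ` {0<..<\<delta>})"
      using \<delta> infinite_Ioo by (simp add: finite_image_iff)
    moreover have "(\<lambda>s. cis (\<theta> * s)) ` {0<..<\<delta>} \<subseteq> {z. (\<Sum>i\<le>m. c i * z ^ i) = 0}"
      using root \<delta> by auto
    ultimately have "infinite {z. (\<Sum>i\<le>m. c i * z ^ i) = 0}"
      using infinite_super by blast
    then have "c k = 0"
      using polyfun_finite_roots[of c m] assms(2) by auto
    then show False using assms by (simp add: c_def)
  qed
  ultimately show ?thesis by (simp add: Q_def)
qed

text \<open>Decay at infinity governs bandwidths near 0, because the argument of the kernel is a
  multiple of \<open>1 / M\<close>.\<close>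

lemma abs_kappa_QS_le:
  assumes "x \<noteq> 0"
  shows "\<bar>kappa_QS x\<bar> \<le> 25 / (6 * pi\<^sup>2) / x\<^sup>2"
proof -
  define c where "c = 6 * pi * x / 5"
  have c: "c \<noteq> 0" using assms by (simp add: c_def)
  have "\<bar>sin c / c\<bar> \<le> 1"
    using c abs_sin_x_le_abs_x[of c] by simp
  then have "\<bar>sin c / c - cos c\<bar> \<le> 2"
    using abs_cos_le_one[of c] by linarith
  then have "\<bar>25 / (12 * pi\<^sup>2 * x\<^sup>2)\<bar> * \<bar>sin c / c - cos c\<bar> \<le> 25 / (12 * pi\<^sup>2 * x\<^sup>2) * 2"
    by (intro mult_mono) auto
  then have "\<bar>25 / (12 * pi\<^sup>2 * x\<^sup>2) * (sin c / c - cos c)\<bar> \<le> 25 / (12 * pi\<^sup>2 * x\<^sup>2) * 2"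
    by (simp only: abs_mult)
  then show ?thesis
    using assms unfolding kappa_QS_def c_def[symmetric] by simp
qed

text \<open>The identity matrix prescribed at bandwidth 0 is the true limit: the diagonal is
  constantly 1 and the other entries vanish by the decay of the kernel. The point 0 matters because
  the bandwidth is 0 wherever \<open>rho_tilde\<close> is 0, which may happen outside
  \<open>N_AM\<close>.\<close>

lemma continuous_on_K_entry: "continuous_on {0..} (\<lambda>M. K_entry M i j)"
proof (cases "i = j")
  case True
  then have "K_entry M i j = 1" for M by (simp add: K_entry_def kappa_QS_def)
  then show ?thesis by (simp add: continuous_on_const)
next
  case False
  define d where "d = \<bar>real i - real j\<bar>"
  have d: "d > 0" using False by (simp add: d_def)
  have "continuous_on {0<..} (\<lambda>M. 25 / (12 * pi\<^sup>2 * (d / M)\<^sup>2) *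
      (sin (6 * pi * (d / M) / 5) / (6 * pi * (d / M) / 5) - cos (6 * pi * (d / M) / 5)))"
    using d by (intro continuous_intros) auto
  then have pos: "continuous_on {0<..} (\<lambda>M. K_entry M i j)"
    using d by (subst continuous_on_cong[OF refl]) (auto simp: K_entry_def kappa_QS_def d_def)
  have "continuous (at M within {0..}) (\<lambda>M. K_entry M i j)" if "M \<ge> 0" for M
  proof (cases "M = 0")
    case True
    have lim: "((\<lambda>M::real. 25 / (6 * pi\<^sup>2) / d\<^sup>2 * M\<^sup>2) \<longlongrightarrow> 25 / (6 * pi\<^sup>2) / d\<^sup>2 * 0\<^sup>2) (at 0 within {0..})"
      by (intro tendsto_intros)
    have "((\<lambda>M. K_entry M i j) \<longlongrightarrow> 0) (at 0 within {0..})"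
    proof (rule Lim_null_comparison)
      show "((\<lambda>M::real. 25 / (6 * pi\<^sup>2) / d\<^sup>2 * M\<^sup>2) \<longlongrightarrow> 0) (at 0 within {0..})"
        using lim by simp
      have "norm (K_entry M i j) \<le> 25 / (6 * pi\<^sup>2) / d\<^sup>2 * M\<^sup>2" if "M \<noteq> 0" for M
        using abs_kappa_QS_le[of "d / M"] that d by (simp add: K_entry_def d_def power_divide)
      then show "\<forall>\<^sub>F M in at 0 within {0..}. norm (K_entry M i j) \<le> 25 / (6 * pi\<^sup>2) / d\<^sup>2 * M\<^sup>2"
        by (auto simp: eventually_at_filter)
    qed
    then show ?thesis using True False by (simp add: continuous_within K_entry_def)
  next
    case False
    then have "isCont (\<lambda>M. K_entry M i j) M"
      using pos that by (simp add: continuous_on_eq_continuous_at)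
    then show ?thesis by (rule continuous_at_imp_continuous_within)
  qed
  then show ?thesis by (simp add: continuous_on_eq_continuous_within)
qed


section \<open>The long-run variance estimator\<close>

lemma sum_A_entry:
  fixes u :: "real^'n::{finite,linorder}"
  assumes "i \<in> {1..CARD('n) - 1}"
  shows "(\<Sum>s\<in>UNIV. A_entry \<rho> i s * u $ s) = coord u (i + 1) - \<rho> * coord u i"
proof -
  have "(\<Sum>s\<in>UNIV. A_entry \<rho> i s * u $ s) =
      (\<Sum>s\<in>UNIV. (\<lambda>m. (if m = i then - \<rho> else if m = i + 1 then 1 else 0) * coord u m) (pos (s::'n)))"
    by (simp add: A_entry_def)
  also have "\<dots> = (\<Sum>m=1..CARD('n). (if m = i then - \<rho> else if m = i + 1 then 1 else 0) * coord u m)"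
    by (rule sum_pos)
  also have "\<dots> = (\<Sum>m\<in>{i, i + 1}. (if m = i then - \<rho> else if m = i + 1 then 1 else 0) * coord u m)"
    using assms by (intro sum.mono_neutral_right) auto
  finally show ?thesis by simp
qed

text \<open>Moves the matrix \<open>A\<close> onto the residuals, so that the estimator becomes a
  quadratic form of the kernel matrix in the prewhitened residuals.\<close>

lemma omega_AM_eq:
  fixes X :: "real^'k^'n::{finite,linorder}"
  shows "omega_AM X y = 1 / (1 - rho_hat X y)\<^sup>2 *
    (\<Sum>i=1..CARD('n) - 1. \<Sum>j=1..CARD('n) - 1.
        v_hat X y i * K_entry (M_AM X y) i j * v_hat X y j) / real CARD('n)"
proof -
  define \<rho> u J where "\<rho> = rho_hat X y" and "u = u_hat X y" and "J = {1..CARD('n) - 1}"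
  define c where "c = 1 / (1 - \<rho>)\<^sup>2"
  define K where "K = K_entry (M_AM X y)"
  have v: "(\<Sum>s\<in>UNIV. A_entry \<rho> i s * u $ s) = v_hat X y i" if "i \<in> J" for i
    using sum_A_entry[of i \<rho> u] that by (simp add: J_def v_hat_def \<rho>_def u_def)
  have "u \<bullet> (W_AM X y *v u) =
      (\<Sum>s\<in>UNIV. \<Sum>t\<in>UNIV. \<Sum>i\<in>J. \<Sum>j\<in>J. c * ((A_entry \<rho> i s * u $ s) * K i j * (A_entry \<rho> j t * u $ t)))"
    by (simp add: inner_vec_def matrix_vector_mult_def W_AM_def \<rho>_def[symmetric] c_def K_def J_def
        sum_distrib_left sum_distrib_right algebra_simps)
  also have "\<dots> = (\<Sum>i\<in>J. \<Sum>j\<in>J. \<Sum>s\<in>UNIV. \<Sum>t\<in>UNIV.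
      c * ((A_entry \<rho> i s * u $ s) * K i j * (A_entry \<rho> j t * u $ t)))"
  proof -
    have "(\<Sum>s\<in>UNIV. \<Sum>t\<in>UNIV. \<Sum>i\<in>J. \<Sum>j\<in>J. f s t i j) = (\<Sum>i\<in>J. \<Sum>j\<in>J. \<Sum>s\<in>UNIV. \<Sum>t\<in>UNIV. f s t i j)"
      for f :: "'n \<Rightarrow> 'n \<Rightarrow> nat \<Rightarrow> nat \<Rightarrow> real"
    proof -
      have "(\<Sum>s\<in>UNIV. \<Sum>t\<in>UNIV. \<Sum>i\<in>J. \<Sum>j\<in>J. f s t i j) = (\<Sum>s\<in>UNIV. \<Sum>i\<in>J. \<Sum>t\<in>UNIV. \<Sum>j\<in>J. f s t i j)"
        by (intro sum.cong refl sum.swap)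
      also have "\<dots> = (\<Sum>i\<in>J. \<Sum>s\<in>UNIV. \<Sum>t\<in>UNIV. \<Sum>j\<in>J. f s t i j)"
        by (rule sum.swap)
      also have "\<dots> = (\<Sum>i\<in>J. \<Sum>s\<in>UNIV. \<Sum>j\<in>J. \<Sum>t\<in>UNIV. f s t i j)"
        by (intro sum.cong refl sum.swap)
      also have "\<dots> = (\<Sum>i\<in>J. \<Sum>j\<in>J. \<Sum>s\<in>UNIV. \<Sum>t\<in>UNIV. f s t i j)"
        by (intro sum.cong refl sum.swap)
      finally show ?thesis .
    qed
    then show ?thesis .
  qed
  also have "\<dots> = (\<Sum>i\<in>J. \<Sum>j\<in>J. c * ((\<Sum>s\<in>UNIV. A_entry \<rho> i s * u $ s) * K i j *
      (\<Sum>t\<in>UNIV. A_entry \<rho> j t * u $ t)))"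
    by (simp add: sum_product sum_distrib_left sum_distrib_right mult_ac)
  also have "\<dots> = c * (\<Sum>i\<in>J. \<Sum>j\<in>J. v_hat X y i * K i j * v_hat X y j)"
    by (simp add: v sum_distrib_left cong: sum.cong)
  finally show ?thesis
    by (simp add: omega_AM_def u_def c_def K_def J_def \<rho>_def)
qed

lemma M_AM_nonneg: "M_AM X y \<ge> 0"
  by (simp add: M_AM_def)

text \<open>A nonzero \<open>v_lag\<close> forces some prewhitened residual to be nonzero, and the
  kernel matrix is strictly definite. Positivity thus holds at every point outside
  \<open>N_AM\<close>, and there the statistic is never set to 0 by a vanishing determinant.\<close>

lemma omega_AM_pos:
  fixes X :: "real^'k^'n::{finite,linorder}"
  assumes "y \<notin> N_AM X"
  shows "omega_AM X y > 0"
proof -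
  let ?n = "CARD('n)"
  have u: "u_lag X y \<noteq> 0" and v: "v_lag X y \<noteq> 0" using assms by (simp_all add: not_in_N_AM_iff)
  then have \<rho>: "rho_hat X y \<noteq> 1" using rho_hat_eq_1_iff u_ssq_nonzero by blast
  obtain k where "k \<in> {1..?n - 2}" "v_hat X y k \<noteq> 0"
    using v unfolding v_lag_def by (metis (no_types, lifting) mult_eq_0_iff sum.neutral)
  then have "(\<Sum>i=1..?n - 1. \<Sum>j=1..?n - 1. v_hat X y i * K_entry (M_AM X y) i j * v_hat X y j) > 0"
    by (intro K_entry_positive_definite[where k=k] M_AM_nonneg) auto
  then show ?thesis
    using \<rho> unfolding omega_AM_eq by (intro divide_pos_pos mult_pos_pos) auto
qed

lemma continuous_on_omega_AM:
  fixes X :: "real^'k^'n::{finite,linorder}"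
  assumes n: "2 \<le> CARD('n)"
  shows "continuous_on (- N_AM X) (omega_AM X)"
proof -
  have u: "u_ssq X y \<noteq> 0" "v_ssq X y \<noteq> 0" "rho_hat X y \<noteq> 1" "rho_tilde X y \<noteq> 1" if "y \<in> - N_AM X" for y
    using that u_ssq_nonzero[of X y] v_ssq_nonzero[of X y] rho_hat_eq_1_iff[of X y]
      rho_tilde_eq_1_iff[OF n, of X y]
    by (auto simp: not_in_N_AM_iff)
  have \<rho>: "continuous_on (- N_AM X) (rho_hat X)"
    unfolding rho_hat_def using u(1) unfolding u_ssq_def
    by (intro continuous_intros) auto
  have v: "continuous_on (- N_AM X) (\<lambda>y. v_hat X y i)" for i
    unfolding v_hat_def by (intro continuous_intros \<rho>)
  have \<rho>': "continuous_on (- N_AM X) (rho_tilde X)"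
    unfolding rho_tilde_def using u(2) unfolding v_ssq_def
    by (intro continuous_intros v) auto
  \<comment> \<open>The base of the power may be 0; continuity survives there because the exponent
    \<open>1 / 5\<close> is positive.\<close>
  have M: "continuous_on (- N_AM X) (M_AM X)"
    unfolding M_AM_def using u(4) by (intro continuous_intros continuous_on_powr' \<rho>') auto
  have K: "continuous_on (- N_AM X) (\<lambda>y. K_entry (M_AM X y) i j)" for i j
    by (rule continuous_on_compose2[OF continuous_on_K_entry M]) (auto simp: M_AM_nonneg)
  show ?thesis
    unfolding omega_AM_eq using u(3) by (intro continuous_intros \<rho> v K) auto
qed

lemma Omega_AM_eq: "Omega_AM X R y = omega_AM X y *\<^sub>R restriction_cov X R"
  by (simp add: Omega_AM_def restriction_cov_def gram_def)

lemma transpose_scaleR: "transpose (c *\<^sub>R A) = c *\<^sub>R transpose (A :: real^'n^'m)"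
  by (simp add: transpose_def vec_eq_iff)

lemma Omega_AM_definite:
  fixes X :: "real^'k^'n::{finite,linorder}" and R :: "real^'k^'q"
  assumes "rank X = CARD('k)" "rank R = CARD('q)" "y \<notin> N_AM X" "x \<noteq> 0"
  shows "x \<bullet> (Omega_AM X R y *v x) > 0"
  using omega_AM_pos[OF assms(3)] restriction_cov_pos[OF assms(1,2,4)]
  by (simp add: Omega_AM_eq scaleR_matrix_vector_assoc[symmetric])

lemma invertible_Omega_AM:
  fixes X :: "real^'k^'n::{finite,linorder}" and R :: "real^'k^'q"
  assumes "rank X = CARD('k)" "rank R = CARD('q)" "y \<notin> N_AM X"
  shows "invertible (Omega_AM X R y)"
  using Omega_AM_definite[OF assms] by (rule invertible_if_definite)

theorem estimator_conditions_AM: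
  fixes X :: "real^'k::{finite,linorder}^'n::{finite,linorder}" and R :: "real^'k::{finite,linorder}^'q"
  assumes n: "2 \<le> CARD('n)" and X: "rank X = CARD('k)" and R: "rank R = CARD('q)"
    and N: "N_AM X \<noteq> UNIV"
  shows "estimator_conditions X (beta_hat X) (Omega_AM X R) (N_AM X)"
  unfolding estimator_conditions_def
proof (intro conjI allI impI)
  show "continuous_on (- N_AM X) (beta_hat X)"
    using linear_beta_hat[of X] by (simp add: linear_continuous_on linear_conv_bounded_linear)
  show "continuous_on (- N_AM X) (Omega_AM X R)"
    unfolding Omega_AM_eq[abs_def] by (intro continuous_intros continuous_on_omega_AM n)
  show "transpose (Omega_AM X R y) = Omega_AM X R y" for y
    using transpose_restriction_cov[OF X, of R] by (simp add: Omega_AM_eq transpose_scaleR)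
  show "beta_hat X (\<delta> *\<^sub>R y + X *v \<eta>) = \<delta> *\<^sub>R beta_hat X y + \<eta>" for \<delta> y \<eta>
    using linear_beta_hat[of X] X by (simp add: linear_add linear_cmul)
  show "Omega_AM X R (\<delta> *\<^sub>R y + X *v \<eta>) = \<delta>\<^sup>2 *\<^sub>R Omega_AM X R y" if "\<delta> \<noteq> 0" for \<delta> y \<eta>
    using omega_AM_affine[OF X that] by (simp add: Omega_AM_eq)
  show "AE y in lborel. y \<notin> N_AM X \<longrightarrow> invertible (Omega_AM X R y)"
    using invertible_Omega_AM[OF X R] by auto
qed (use not_in_N_AM_affine[OF X] closed_N_AM N_AM_null_sets[OF N] in auto)


section \<open>Autoregressive spectral densities with poles close to the unit circle\<close>

lemma abs_sin_nat_mult_le: "\<bar>sin (real p * x)\<bar> \<le> real p * \<bar>sin x\<bar>"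
proof (induction p)
  case (Suc p)
  have "\<bar>sin (real (Suc p) * x)\<bar> = \<bar>sin (real p * x) * cos x + cos (real p * x) * sin x\<bar>"
    by (simp add: distrib_right sin_add algebra_simps)
  also have "\<dots> \<le> \<bar>sin (real p * x)\<bar> * \<bar>cos x\<bar> + \<bar>cos (real p * x)\<bar> * \<bar>sin x\<bar>"
    by (metis abs_mult abs_triangle_ineq)
  also have "\<dots> \<le> \<bar>sin (real p * x)\<bar> * 1 + 1 * \<bar>sin x\<bar>"
    by (intro add_mono mult_mono) auto
  finally show ?case using Suc by (simp add: distrib_right)
qed simp

text \<open>Distance is measured through \<open>cos\<close> since the density will concentrate at
  both \<nu> and -\<nu>, which \<open>cos\<close> does not distinguish. The product formula for
  differences of cosines reduces the claim to multiple angles of \<open>sin\<close>.\<close>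

lemma abs_cos_nat_mult_diff_le:
  "\<bar>cos (real p * x) - cos (real p * y)\<bar> \<le> (real p)\<^sup>2 * \<bar>cos x - cos y\<bar>"
proof -
  define u v where "u = (x + y) / 2" and "v = (y - x) / 2"
  have "cos (real p * x) - cos (real p * y) = 2 * sin (real p * u) * sin (real p * v)"
    by (simp add: cos_diff_cos u_def v_def algebra_simps diff_divide_distrib add_divide_distrib)
  then have "\<bar>cos (real p * x) - cos (real p * y)\<bar> = 2 * (\<bar>sin (real p * u)\<bar> * \<bar>sin (real p * v)\<bar>)"
    by (simp add: abs_mult)
  also have "\<dots> \<le> 2 * ((real p * \<bar>sin u\<bar>) * (real p * \<bar>sin v\<bar>))"
    by (intro mult_left_mono mult_mono abs_sin_nat_mult_le) auto
  also have "\<dots> = (real p)\<^sup>2 * \<bar>2 * sin u * sin v\<bar>"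
    by (simp add: abs_mult power2_eq_square)
  also have "2 * sin u * sin v = cos x - cos y"
    by (simp add: cos_diff_cos u_def v_def)
  finally show ?thesis .
qed

text \<open>The squared modulus of the autoregressive polynomial with inverse roots
  \<open>\<rho> * cis \<nu>\<close> and \<open>\<rho> * cis (- \<nu>)\<close>. The coefficients are
  kept in the shape that \<open>spec_AR2\<close> expects.\<close>

definition ar2_denom :: "real \<Rightarrow> real \<Rightarrow> real \<Rightarrow> real" where
  "ar2_denom \<rho> \<nu> \<omega> = (cmod (1 - of_real (2 * \<rho> * cos \<nu>) * cis (- \<omega>) - of_real (- (\<rho>\<^sup>2)) * cis (- 2 * \<omega>)))\<^sup>2"

lemma ar2_polynomial_factor:
  "1 - of_real (2 * \<rho> * cos \<nu>) * z - of_real (- (\<rho>\<^sup>2)) * z\<^sup>2 =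
    (1 - of_real \<rho> * cis \<nu> * z) * (1 - of_real \<rho> * cis (- \<nu>) * z)"
proof -
  have sum: "of_real (2 * cos \<nu>) = cis \<nu> + cis (- \<nu>)" and prod: "cis \<nu> * cis (- \<nu>) = 1"
    by (simp_all add: complex_eq_iff cis_mult)
  have "(1 - of_real \<rho> * cis \<nu> * z) * (1 - of_real \<rho> * cis (- \<nu>) * z) =
      1 - of_real \<rho> * (cis \<nu> + cis (- \<nu>)) * z + (of_real \<rho>)\<^sup>2 * (cis \<nu> * cis (- \<nu>)) * z\<^sup>2"
    by (simp add: algebra_simps power2_eq_square)
  then show ?thesis
    unfolding prod sum[symmetric] by simp
qed

lemma ar2_polynomial_nonzero:
  assumes "0 < \<rho>" "\<rho> < 1" "cmod z \<le> 1"
  shows "1 - of_real (2 * \<rho> * cos \<nu>) * z - of_real (- (\<rho>\<^sup>2)) * z\<^sup>2 \<noteq> 0"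
proof -
  have "1 - of_real \<rho> * cis a * z \<noteq> 0" for a
  proof
    assume "1 - of_real \<rho> * cis a * z = 0"
    then have "cmod (of_real \<rho> * cis a * z) = 1" by (metis eq_iff_diff_eq_0 norm_one)
    then have "\<rho> * cmod z = 1" using assms by (simp add: norm_mult)
    moreover have "\<rho> * cmod z \<le> \<rho> * 1" using assms by (intro mult_left_mono) auto
    ultimately show False using assms by simp
  qed
  then show ?thesis unfolding ar2_polynomial_factor by simp
qed

lemma cis_minus_double: "cis (- 2 * \<omega>) = (cis (- \<omega>))\<^sup>2"
  by (simp add: power2_eq_square cis_mult)

lemma ar2_denom_pos: "0 < \<rho> \<Longrightarrow> \<rho> < 1 \<Longrightarrow> ar2_denom \<rho> \<nu> \<omega> > 0"
  using ar2_polynomial_nonzero[of \<rho> "cis (- \<omega>)" \<nu>] unfolding ar2_denom_def cis_minus_double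
  by simp

text \<open>Multiplying by \<open>cis \<omega>\<close>, of modulus 1, symmetrizes the polynomial.
  The real part is then nearly a multiple of \<open>cos \<omega> - cos \<nu>\<close>, the quantity
  to be controlled, and evenness in \<omega> is visible.\<close>

lemma ar2_denom_eq:
  "ar2_denom \<rho> \<nu> \<omega> = ((1 + \<rho>\<^sup>2) * cos \<omega> - 2 * \<rho> * cos \<nu>)\<^sup>2 + ((1 - \<rho>\<^sup>2) * sin \<omega>)\<^sup>2"
proof -
  define w where "w = 1 - of_real (2 * \<rho> * cos \<nu>) * cis (- \<omega>) - of_real (- (\<rho>\<^sup>2)) * cis (- 2 * \<omega>)"
  have "cis \<omega> * w = cis \<omega> - of_real (2 * \<rho> * cos \<nu>) * (cis \<omega> * cis (- \<omega>)) +
      of_real (\<rho>\<^sup>2) * (cis \<omega> * cis (- 2 * \<omega>))"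
    by (simp add: w_def algebra_simps)
  also have "\<dots> = Complex ((1 + \<rho>\<^sup>2) * cos \<omega> - 2 * \<rho> * cos \<nu>) ((1 - \<rho>\<^sup>2) * sin \<omega>)"
    by (simp add: cis_mult complex_eq_iff algebra_simps)
  finally have "(cmod (cis \<omega> * w))\<^sup>2 = ((1 + \<rho>\<^sup>2) * cos \<omega> - 2 * \<rho> * cos \<nu>)\<^sup>2 + ((1 - \<rho>\<^sup>2) * sin \<omega>)\<^sup>2"
    by (simp add: cmod_power2)
  then show ?thesis by (simp add: norm_mult ar2_denom_def w_def)
qed

lemma norm_one_minus_cis_le: "cmod (1 - cis x) \<le> \<bar>x\<bar>"
  using iexp_approx1[of x 0] by (simp add: cis_conv_exp norm_minus_commute mult.commute)

text \<open>Near \<nu> the factor of the nearby root is at most \<open>2 * (1 - \<rho>)\<close> and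
  the other factor at most 2; 16 is the square of the product of the constants.\<close>

lemma ar2_denom_le:
  assumes "0 < \<rho>" "\<rho> < 1" "\<bar>\<omega> - \<nu>\<bar> \<le> 1 - \<rho>"
  shows "ar2_denom \<rho> \<nu> \<omega> \<le> 16 * (1 - \<rho>)\<^sup>2"
proof -
  have "1 - of_real \<rho> * cis \<nu> * cis (- \<omega>) = of_real (1 - \<rho>) + of_real \<rho> * (1 - cis (\<nu> - \<omega>))"
    by (simp add: cis_mult algebra_simps)
  then have "cmod (1 - of_real \<rho> * cis \<nu> * cis (- \<omega>)) \<le> (1 - \<rho>) + \<rho> * cmod (1 - cis (\<nu> - \<omega>))"
    using assms by (metis abs_of_pos diff_gt_0_iff_gt norm_mult norm_of_real norm_triangle_ineq)
  also have "\<rho> * cmod (1 - cis (\<nu> - \<omega>)) \<le> 1 * \<bar>\<nu> - \<omega>\<bar>"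
    using assms by (intro mult_mono norm_one_minus_cis_le) auto
  finally have 1: "cmod (1 - of_real \<rho> * cis \<nu> * cis (- \<omega>)) \<le> 2 * (1 - \<rho>)"
    using assms by simp
  have "cmod (1 - of_real \<rho> * cis (- \<nu>) * cis (- \<omega>)) \<le> 1 + \<rho>"
    using norm_triangle_ineq4[of 1 "of_real \<rho> * cis (- \<nu>) * cis (- \<omega>)"] assms
    by (simp add: norm_mult)
  then have 2: "cmod (1 - of_real \<rho> * cis (- \<nu>) * cis (- \<omega>)) \<le> 2" using assms by simp
  have "cmod (1 - of_real \<rho> * cis \<nu> * cis (- \<omega>)) * cmod (1 - of_real \<rho> * cis (- \<nu>) * cis (- \<omega>))
      \<le> (2 * (1 - \<rho>)) * 2"
    using assms by (intro mult_mono 1 2) auto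
  then have "(cmod ((1 - of_real \<rho> * cis \<nu> * cis (- \<omega>)) * (1 - of_real \<rho> * cis (- \<nu>) * cis (- \<omega>))))\<^sup>2
      \<le> ((2 * (1 - \<rho>)) * 2)\<^sup>2"
    by (intro power_mono) (auto simp: norm_mult)
  also have "\<dots> = 16 * (1 - \<rho>)\<^sup>2"
    by (simp add: power2_eq_square algebra_simps)
  finally show ?thesis
    unfolding ar2_denom_def cis_minus_double ar2_polynomial_factor .
qed

lemma continuous_on_ar2_denom: "continuous_on S (ar2_denom \<rho> \<nu>)"
  unfolding ar2_denom_def[abs_def] cis_conv_exp by (intro continuous_intros)

definition ar2_mass :: "real \<Rightarrow> real \<Rightarrow> real" where
  "ar2_mass \<rho> \<nu> = integral {-pi..pi} (\<lambda>\<omega>. 1 / ar2_denom \<rho> \<nu> \<omega>)"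

definition ar2_density :: "real \<Rightarrow> real \<Rightarrow> real \<Rightarrow> real" where
  "ar2_density \<rho> \<nu> = (\<lambda>\<omega>. 1 / (ar2_mass \<rho> \<nu> * ar2_denom \<rho> \<nu> \<omega>))"

context
  fixes \<rho> \<nu> :: real
  assumes \<rho>: "0 < \<rho>" "\<rho> < 1" and \<nu>: "0 < \<nu>" "\<nu> < 1"
begin

lemma continuous_on_inverse_ar2_denom: "continuous_on S (\<lambda>\<omega>. 1 / ar2_denom \<rho> \<nu> \<omega>)"
  using ar2_denom_pos[OF \<rho>] by (intro continuous_intros continuous_on_ar2_denom) (metis less_irrefl)

text \<open>Integrates over an interval of length \<open>1 - \<rho>\<close> beside the peak only.
  The resulting blow-up as \<rho> tends to 1 drives the concentration.\<close>

lemma ar2_mass_ge: "ar2_mass \<rho> \<nu> \<ge> 1 / (16 * (1 - \<rho>))"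
proof -
  have sub: "{\<nu>..\<nu> + (1 - \<rho>)} \<subseteq> {-pi..pi}" using \<rho> \<nu> pi_gt3 by auto
  have int: "(\<lambda>\<omega>. 1 / ar2_denom \<rho> \<nu> \<omega>) integrable_on {a..b}" for a b
    by (intro integrable_continuous_real continuous_on_inverse_ar2_denom)
  have "1 / (16 * (1 - \<rho>)) = integral {\<nu>..\<nu> + (1 - \<rho>)} (\<lambda>\<omega>. 1 / (16 * (1 - \<rho>)\<^sup>2))"
    using \<rho> by (simp add: power2_eq_square)
  also have "\<dots> \<le> integral {\<nu>..\<nu> + (1 - \<rho>)} (\<lambda>\<omega>. 1 / ar2_denom \<rho> \<nu> \<omega>)"
    using ar2_denom_le[OF \<rho>, of _ \<nu>] ar2_denom_pos[OF \<rho>, of \<nu>] \<rho>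
    by (intro integral_le int) (auto intro!: divide_left_mono)
  also have "\<dots> \<le> ar2_mass \<rho> \<nu>"
    unfolding ar2_mass_def using ar2_denom_pos[OF \<rho>, of \<nu>]
    by (intro integral_subset_le sub int) (simp add: less_imp_le)
  finally show ?thesis .
qed

lemma ar2_mass_pos: "ar2_mass \<rho> \<nu> > 0"
  using ar2_mass_ge \<rho> by (smt (verit) divide_pos_pos)

lemma continuous_on_ar2_density: "continuous_on S (ar2_density \<rho> \<nu>)"
proof -
  have "ar2_density \<rho> \<nu> = (\<lambda>\<omega>. 1 / ar2_mass \<rho> \<nu> * (1 / ar2_denom \<rho> \<nu> \<omega>))"
    by (simp add: ar2_density_def)
  then show ?thesis
    by (simp only:) (intro continuous_intros continuous_on_inverse_ar2_denom)
qed

lemma ar2_density_pos: "ar2_density \<rho> \<nu> \<omega> > 0"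
  using ar2_mass_pos ar2_denom_pos[OF \<rho>] by (simp add: ar2_density_def)

lemma has_integral_ar2_density: "(ar2_density \<rho> \<nu> has_integral 1) {-pi..pi}"
proof -
  have "((\<lambda>\<omega>. 1 / ar2_denom \<rho> \<nu> \<omega>) has_integral ar2_mass \<rho> \<nu>) {-pi..pi}"
    unfolding ar2_mass_def
    by (intro integrable_integral integrable_continuous_real continuous_on_inverse_ar2_denom)
  from has_integral_mult_right[OF this, of "1 / ar2_mass \<rho> \<nu>"] show ?thesis
    using ar2_mass_pos by (simp add: ar2_density_def)
qed

lemma ar2_density_in_spec_AR2: "restrict (ar2_density \<rho> \<nu>) {-pi..pi} \<in> spec_AR2"
proof -
  let ?f = "restrict (ar2_density \<rho> \<nu>) {-pi..pi}"
  have int: "set_integrable lebesgue {-pi..pi} (ar2_density \<rho> \<nu>)"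
    by (intro absolutely_integrable_continuous_real continuous_on_ar2_density)
  have int': "set_integrable lebesgue {-pi..pi} ?f"
    using int by (subst set_integrable_cong[OF refl refl]) auto
  have "(LINT \<omega>:{-pi..pi}|lebesgue. ?f \<omega>) = integral {-pi..pi} ?f"
    using int' by (rule set_lebesgue_integral_eq_integral)
  also have "\<dots> = integral {-pi..pi} (ar2_density \<rho> \<nu>)"
    by (rule integral_cong) auto
  also have "\<dots> = 1" using has_integral_ar2_density by (rule integral_unique)
  finally have one: "(LINT \<omega>:{-pi..pi}|lebesgue. ?f \<omega>) = 1" .
  have "?f \<in> {-pi..pi} \<rightarrow>\<^sub>E {0..}"
    using ar2_density_pos by (auto simp: less_imp_le)
  moreover have "\<forall>\<omega>\<in>{-pi..pi}. ?f (-\<omega>) = ?f \<omega>"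
    by (auto simp: ar2_density_def ar2_denom_eq)
  ultimately have "?f \<in> spec_all"
    unfolding spec_all_def using int' one by blast
  moreover have "\<exists>a1 a2 s. s > 0 \<and>
     (\<forall>z::complex. cmod z \<le> 1 \<longrightarrow> 1 - of_real a1 * z - of_real a2 * z^2 \<noteq> 0) \<and>
     (\<forall>\<omega>\<in>{-pi..pi}. ?f \<omega> =
        s / (2 * pi) / (cmod (1 - of_real a1 * cis (-\<omega>) - of_real a2 * cis (-2 * \<omega>)))^2)"
  proof (intro exI conjI allI impI ballI)
    \<comment> \<open>The witness for the innovation variance: normalizing the density to mass 1
      determines it.\<close>
    show "2 * pi / ar2_mass \<rho> \<nu> > 0" using ar2_mass_pos by simp
    show "1 - of_real (2 * \<rho> * cos \<nu>) * z - of_real (- (\<rho>\<^sup>2)) * z^2 \<noteq> 0" if "cmod z \<le> 1" for z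
      using ar2_polynomial_nonzero[OF \<rho> that] .
    show "?f \<omega> = 2 * pi / ar2_mass \<rho> \<nu> / (2 * pi) /
        (cmod (1 - of_real (2 * \<rho> * cos \<nu>) * cis (-\<omega>) - of_real (- (\<rho>\<^sup>2)) * cis (-2 * \<omega>)))^2"
      if "\<omega> \<in> {-pi..pi}" for \<omega>
      unfolding ar2_denom_def[symmetric] using that by (simp add: ar2_density_def)
  qed
  ultimately show ?thesis unfolding spec_AR2_def by blast
qed

text \<open>
  The prediction error variance \<open>\<integral> ar2_denom * ar2_density = 2 pi / ar2_mass\<close> tends to 0, which
  forces the density to concentrate at \<open>\<plusminus>\<nu>\<close>.
\<close>

lemma integral_abs_cos_diff_ar2_density_le:
  assumes t: "0 < t" "t \<le> 1 / 2" and \<rho>t: "\<rho> = 1 - t\<^sup>2"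
  shows "integral {-pi..pi} (\<lambda>\<omega>. \<bar>cos \<omega> - cos \<nu>\<bar> * ar2_density \<rho> \<nu> \<omega>) \<le> 70 * t"
proof -
  let ?f = "ar2_density \<rho> \<nu>"
  have "t\<^sup>2 \<le> (1 / 2)\<^sup>2" using t by (intro power_mono) auto
  then have \<rho>2: "\<rho> \<ge> 1 / 2" by (simp add: \<rho>t power2_eq_square)
  have bound: "\<bar>cos \<omega> - cos \<nu>\<bar> * ?f \<omega> \<le> (t / 2 + t ^ 4) * ?f \<omega> + 1 / (2 * t * ar2_mass \<rho> \<nu>)" for \<omega>
  proof -
    define A where "A = (1 + \<rho>\<^sup>2) * cos \<omega> - 2 * \<rho> * cos \<nu>"
    \<comment> \<open>Here \<open>1 + \<rho>\<^sup>2 - 2 * \<rho> = (1 - \<rho>)\<^sup>2 = t ^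
      4\<close>; later \<open>\<rho> \<ge> 1 / 2\<close> allows the factor \<open>2 * \<rho>\<close>
      to be dropped.\<close>
    have "2 * \<rho> * (cos \<omega> - cos \<nu>) = A - t ^ 4 * cos \<omega>"
      by (simp add: A_def \<rho>t algebra_simps power2_eq_square power4_eq_xxxx)
    then have "2 * \<rho> * \<bar>cos \<omega> - cos \<nu>\<bar> = \<bar>A - t ^ 4 * cos \<omega>\<bar>"
      using \<rho> by (metis abs_mult abs_of_pos mult_pos_pos zero_less_numeral)
    also have "\<dots> \<le> \<bar>A\<bar> + t ^ 4 * 1"
    proof -
      have "\<bar>t ^ 4 * cos \<omega>\<bar> \<le> t ^ 4 * 1"
        unfolding abs_mult using t by (intro mult_mono) auto
      then show ?thesis using abs_triangle_ineq4[of A "t ^ 4 * cos \<omega>"] by linarith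
    qed
    finally have "2 * \<rho> * \<bar>cos \<omega> - cos \<nu>\<bar> \<le> \<bar>A\<bar> + t ^ 4" by simp
    moreover have "1 * \<bar>cos \<omega> - cos \<nu>\<bar> \<le> 2 * \<rho> * \<bar>cos \<omega> - cos \<nu>\<bar>"
      using \<rho>2 by (intro mult_right_mono) auto
    ultimately have 1: "\<bar>cos \<omega> - cos \<nu>\<bar> \<le> \<bar>A\<bar> + t ^ 4" by simp
    \<comment> \<open>Young's inequality with weight \<open>t\<close>. The square is absorbed by the
      denominator of the density, and the choice \<open>1 - \<rho> = t\<^sup>2\<close> makes both
      resulting terms of order \<open>t\<close> after integration.\<close>
    have "\<bar>A\<bar> \<le> t / 2 + A\<^sup>2 / (2 * t)"
    proof -
      have "0 \<le> (\<bar>A\<bar> - t)\<^sup>2" by simp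
      then have "2 * t * \<bar>A\<bar> \<le> t\<^sup>2 + A\<^sup>2" by (simp add: power2_diff algebra_simps)
      then show ?thesis using t by (simp add: field_simps power2_eq_square)
    qed
    also have "\<dots> \<le> t / 2 + ar2_denom \<rho> \<nu> \<omega> / (2 * t)"
      using t by (intro add_left_mono divide_right_mono) (auto simp: ar2_denom_eq A_def)
    finally have "\<bar>A\<bar> + t ^ 4 \<le> (t / 2 + t ^ 4) + ar2_denom \<rho> \<nu> \<omega> / (2 * t)" by simp
    with 1 have "\<bar>cos \<omega> - cos \<nu>\<bar> \<le> (t / 2 + t ^ 4) + ar2_denom \<rho> \<nu> \<omega> / (2 * t)"
      by (rule order_trans)
    then have "\<bar>cos \<omega> - cos \<nu>\<bar> * ?f \<omega> \<le> ((t / 2 + t ^ 4) + ar2_denom \<rho> \<nu> \<omega> / (2 * t)) * ?f \<omega>"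
      by (intro mult_right_mono) (auto simp: less_imp_le ar2_density_pos)
    also have "\<dots> = (t / 2 + t ^ 4) * ?f \<omega> + 1 / (2 * t * ar2_mass \<rho> \<nu>)"
      using t ar2_denom_pos[OF \<rho>, of \<nu> \<omega>] unfolding distrib_right ar2_density_def by simp
    finally show ?thesis .
  qed
  have "((\<lambda>\<omega>. (t / 2 + t ^ 4) * ?f \<omega> + 1 / (2 * t * ar2_mass \<rho> \<nu>)) has_integral
      (t / 2 + t ^ 4) * 1 + measure lborel {-pi..pi} *\<^sub>R (1 / (2 * t * ar2_mass \<rho> \<nu>))) {-pi..pi}"
    by (intro has_integral_add has_integral_mult_right has_integral_ar2_density has_integral_const_real)
  then have "integral {-pi..pi} (\<lambda>\<omega>. \<bar>cos \<omega> - cos \<nu>\<bar> * ?f \<omega>) \<le>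
      (t / 2 + t ^ 4) * 1 + measure lborel {-pi..pi} *\<^sub>R (1 / (2 * t * ar2_mass \<rho> \<nu>))"
    by (intro has_integral_le[OF integrable_integral])
      (auto intro!: integrable_continuous_real continuous_intros continuous_on_ar2_density simp: bound)
  also have "measure lborel {-pi..pi} *\<^sub>R (1 / (2 * t * ar2_mass \<rho> \<nu>)) = pi / t * (1 / ar2_mass \<rho> \<nu>)"
    by simp
  also have "\<dots> \<le> pi / t * (16 * t\<^sup>2)"
  proof -
    have "1 / (16 * t\<^sup>2) \<le> ar2_mass \<rho> \<nu>" using ar2_mass_ge by (simp add: \<rho>t)
    then have "1 / ar2_mass \<rho> \<nu> \<le> 16 * t\<^sup>2"
      using ar2_mass_pos t by (simp add: field_simps)
    then show ?thesis using t by (intro mult_left_mono) auto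
  qed
  also have "pi / t * (16 * t\<^sup>2) = 16 * pi * t"
    using t by (simp add: power2_eq_square)
  \<comment> \<open>The constant 70 is a round bound for \<open>1 / 2 + 1 + 64\<close>, where 64
    comes from \<open>pi < 4\<close>.\<close>
  also have "(t / 2 + t ^ 4) * 1 + 16 * pi * t \<le> 70 * t"
  proof -
    have "t ^ 4 \<le> t" using t power_decreasing[of 1 4 t] by simp
    moreover have "16 * pi * t \<le> 64 * t"
      using t pi_less_4 by (intro mult_right_mono) auto
    ultimately have "t / 2 + t ^ 4 + 16 * pi * t \<le> t / 2 + t + 64 * t"
      by (intro add_mono order_refl)
    then show ?thesis using t by simp
  qed
  finally show ?thesis by simp
qed

text \<open>The integral is the autocovariance at lag \<open>p\<close>. The bound does not involve
  \<nu>, which is essential because \<nu> will itself tend to 0.\<close>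

lemma ar2_density_cos_moment_le:
  assumes t: "0 < t" "t \<le> 1 / 2" and \<rho>t: "\<rho> = 1 - t\<^sup>2"
  shows "\<bar>integral {-pi..pi} (\<lambda>\<omega>. cos (real p * \<omega>) * ar2_density \<rho> \<nu> \<omega>) - cos (real p * \<nu>)\<bar>
    \<le> (real p)\<^sup>2 * (70 * t)"
proof -
  let ?f = "ar2_density \<rho> \<nu>"
  have "(\<lambda>\<omega>. cos (real p * \<omega>) * ?f \<omega>) integrable_on {-pi..pi}"
    by (intro integrable_continuous_real continuous_intros continuous_on_ar2_density)
  from has_integral_diff[OF integrable_integral[OF this]
      has_integral_mult_right[OF has_integral_ar2_density, of "cos (real p * \<nu>)"]]
  have eq: "integral {-pi..pi} (\<lambda>\<omega>. cos (real p * \<omega>) * ?f \<omega>) - cos (real p * \<nu>) =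
      integral {-pi..pi} (\<lambda>\<omega>. (cos (real p * \<omega>) - cos (real p * \<nu>)) * ?f \<omega>)"
    by (simp add: integral_unique left_diff_distrib)
  have "norm (integral {-pi..pi} (\<lambda>\<omega>. (cos (real p * \<omega>) - cos (real p * \<nu>)) * ?f \<omega>)) \<le>
      integral {-pi..pi} (\<lambda>\<omega>. (real p)\<^sup>2 * (\<bar>cos \<omega> - cos \<nu>\<bar> * ?f \<omega>))"
  proof (rule integral_norm_bound_integral)
    show "norm ((cos (real p * \<omega>) - cos (real p * \<nu>)) * ?f \<omega>) \<le> (real p)\<^sup>2 * (\<bar>cos \<omega> - cos \<nu>\<bar> * ?f \<omega>)" for \<omega>
      using mult_right_mono[OF abs_cos_nat_mult_diff_le[of p \<omega> \<nu>], of "?f \<omega>"] ar2_density_pos[of \<omega>]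
      by (simp add: abs_mult)
  qed (intro integrable_continuous_real continuous_intros continuous_on_ar2_density)+
  also have "\<dots> = (real p)\<^sup>2 * integral {-pi..pi} (\<lambda>\<omega>. \<bar>cos \<omega> - cos \<nu>\<bar> * ?f \<omega>)"
    by simp
  also have "\<dots> \<le> (real p)\<^sup>2 * (70 * t)"
    using integral_abs_cos_diff_ar2_density_le[OF assms] by (intro mult_left_mono) auto
  finally show ?thesis by (simp add: eq)
qed

end


section \<open>Covariance matrices\<close>

lemma Sigma_mat_eq_integral:
  fixes f :: "real \<Rightarrow> real" and j l :: "'n::{finite,linorder}"
  assumes f: "continuous_on {-pi..pi} f"
  shows "(Sigma_mat f :: real^'n::{finite,linorder}^'n::{finite,linorder}) $ j $ l =
    integral {-pi..pi} (\<lambda>\<omega>. cos (real (pos j) * \<omega> - real (pos l) * \<omega>) * f \<omega>)"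
proof -
  let ?e = "\<lambda>\<omega>. exp (- \<i> * of_real ((real (pos j) - real (pos l)) * \<omega>)) * of_real (f \<omega>)"
  have int: "set_integrable lebesgue {-pi..pi} ?e"
    by (intro absolutely_integrable_continuous_real continuous_intros f)
  have "(LINT \<omega>:{-pi..pi}|lebesgue. ?e \<omega>) = integral {-pi..pi} ?e"
    using int by (rule set_lebesgue_integral_eq_integral)
  moreover have "?e integrable_on {-pi..pi}"
    by (intro integrable_continuous_real continuous_intros f)
  then have "Re (integral {-pi..pi} ?e) = integral {-pi..pi} (\<lambda>\<omega>. Re (?e \<omega>))"
    by (simp only: integral_linear[OF _ bounded_linear_Re, unfolded o_def])
  moreover have "Re (?e \<omega>) = cos (real (pos j) * \<omega> - real (pos l) * \<omega>) * f \<omega>" for \<omega>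
    by (simp add: Re_exp left_diff_distrib) (metis cos_minus minus_diff_eq)
  ultimately show ?thesis unfolding Sigma_mat_def vec_lambda_beta by (simp only:)
qed

text \<open>The quadratic form is the integral of the squared modulus of a trigonometric polynomial
  against \<open>f\<close>.\<close>

lemma Sigma_mat_psd:
  fixes f :: "real \<Rightarrow> real" and z :: "real^'n::{finite,linorder}"
  assumes f: "continuous_on {-pi..pi} f" "\<And>\<omega>. \<omega> \<in> {-pi..pi} \<Longrightarrow> f \<omega> \<ge> 0"
  shows "z \<bullet> (Sigma_mat f *v z) \<ge> 0"
proof -
  have S: "((\<lambda>\<omega>. z $ j * (cos (real (pos j) * \<omega> - real (pos l) * \<omega>) * f \<omega>) * z $ l) has_integral
      z $ j * (Sigma_mat f $ j $ l) * z $ l) {-pi..pi}" for j l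
    unfolding Sigma_mat_eq_integral[OF f(1)]
    by (intro has_integral_mult_left has_integral_mult_right integrable_integral
        integrable_continuous_real continuous_intros f)
  have "z \<bullet> (Sigma_mat f *v z) = (\<Sum>j\<in>UNIV. \<Sum>l\<in>UNIV. z $ j * (Sigma_mat f $ j $ l) * z $ l)"
    by (simp add: inner_vec_def matrix_vector_mult_def sum_distrib_left algebra_simps)
  moreover have "((\<lambda>\<omega>. \<Sum>j\<in>UNIV. \<Sum>l\<in>UNIV. z $ j * (cos (real (pos j) * \<omega> - real (pos l) * \<omega>) * f \<omega>) * z $ l)
      has_integral (\<Sum>j\<in>UNIV. \<Sum>l\<in>UNIV. z $ j * (Sigma_mat f $ j $ l) * z $ l)) {-pi..pi}"
    by (intro has_integral_sum S) auto
  moreover have "(\<Sum>j\<in>UNIV. \<Sum>l\<in>UNIV. z $ j * (cos (real (pos j) * \<omega> - real (pos l) * \<omega>) * f \<omega>) * z $ l) =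
      (cmod (\<Sum>i\<in>UNIV. of_real (z $ i) * cis (real (pos i) * \<omega>)))\<^sup>2 * f \<omega>" for \<omega>
    unfolding sum_cos_differences[symmetric] by (simp add: sum_distrib_left algebra_simps)
  ultimately have "((\<lambda>\<omega>. (cmod (\<Sum>i\<in>UNIV. of_real (z $ i) * cis (real (pos i) * \<omega>)))\<^sup>2 * f \<omega>)
      has_integral z \<bullet> (Sigma_mat f *v z)) {-pi..pi}"
    by (simp only:)
  then show ?thesis
    by (rule has_integral_nonneg) (intro mult_nonneg_nonneg zero_le_power2 f)
qed

lemma transpose_Sigma_mat:
  assumes "continuous_on {-pi..pi} f"
  shows "transpose (Sigma_mat f :: real^'a::{finite,linorder}^'a::{finite,linorder}) = Sigma_mat f"
proof -
  have "Sigma_mat f $ j $ l = Sigma_mat f $ l $ j" for j l :: 'a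
    by (simp add: Sigma_mat_eq_integral[OF assms] cos_diff mult.commute)
  then show ?thesis by (simp add: vec_eq_iff transpose_def)
qed

lemma integral_cos_full_period:
  "integral {-pi..pi} (\<lambda>\<omega>. cos (real_of_int p * \<omega>)) = (if p = 0 then 2 * pi else 0)"
proof (cases "p = 0")
  case False
  have "((\<lambda>\<omega>. cos (real_of_int p * \<omega>)) has_integral
      sin (real_of_int p * pi) / real_of_int p - sin (real_of_int p * (- pi)) / real_of_int p) {-pi..pi}"
    using False by (intro fundamental_theorem_of_calculus)
      (auto intro!: derivative_eq_intros simp flip: has_real_derivative_iff_has_vector_derivative)
  then show ?thesis using False by (simp add: integral_unique sin_zero_iff_int2 mult.commute)
qed simp

text \<open>Packages the inner limit: the tolerance \<epsilon> may be chosen after \<nu> and the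
  share \<open>c\<close> of white noise, whose covariance is the identity.\<close>

lemma ex_spec_AR2_ext_near_cosine:
  fixes \<nu> \<epsilon> c :: real
  assumes \<nu>: "0 < \<nu>" "\<nu> < 1" and \<epsilon>: "0 < \<epsilon>" and c: "0 \<le> c" "c \<le> 1"
  obtains f where "f \<in> spec_AR2_ext"
    "transpose (Sigma_mat f :: real^'n::{finite,linorder}^'n::{finite,linorder}) = Sigma_mat f"
    "\<And>z :: real^'n::{finite,linorder}. z \<bullet> (Sigma_mat f *v z) \<ge> 0"
    "\<And>j l :: 'n. \<bar>Sigma_mat f $ j $ l - ((1 - c) * cos (real (pos j) * \<nu> - real (pos l) * \<nu>) +
        c * (if j = l then 1 else 0))\<bar> \<le> \<epsilon>"
proof -
  define n where "n = real CARD('n)"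
  have n: "n \<ge> 1" by (simp add: n_def Suc_le_eq)
  \<comment> \<open>All lags are at most \<open>n\<close>, so the moment bound
    \<open>n\<^sup>2 * (70 * t)\<close> must not exceed \<epsilon>; the moment estimate also asks
    for \<open>t \<le> 1 / 2\<close>.\<close>
  define t where "t = min (1 / 2) (\<epsilon> / (70 * n\<^sup>2))"
  have t: "0 < t" "t \<le> 1 / 2" "n\<^sup>2 * (70 * t) \<le> \<epsilon>"
    using \<epsilon> n by (auto simp: t_def min_def field_simps)
  define \<rho> where "\<rho> = 1 - t\<^sup>2"
  have "t\<^sup>2 \<le> (1 / 2)\<^sup>2" using t by (intro power_mono) auto
  then have \<rho>: "0 < \<rho>" "\<rho> < 1" using t by (auto simp: \<rho>_def power2_eq_square)
  define g where "g = ar2_density \<rho> \<nu>"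
  have g: "continuous_on S g" "g \<omega> > 0" for S \<omega>
    using continuous_on_ar2_density[OF \<rho> \<nu>] ar2_density_pos[OF \<rho> \<nu>] by (auto simp: g_def)
  define h where "h \<omega> = (1 - c) * g \<omega> + c / (2 * pi)" for \<omega>
  have h: "continuous_on S h" "h \<omega> \<ge> 0" for S \<omega>
    unfolding h_def using c g(2)[of \<omega>] by (auto intro!: continuous_intros g add_nonneg_nonneg)
  define f where "f = restrict h {-pi..pi}"
  have f: "continuous_on {-pi..pi} f" "\<omega> \<in> {-pi..pi} \<Longrightarrow> f \<omega> \<ge> 0" for \<omega>
  proof -
    show "continuous_on {-pi..pi} f"
      using h(1)[of "{-pi..pi}"] by (subst continuous_on_cong[OF refl, of _ _ h]) (auto simp: f_def)
  qed (auto simp: f_def h)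
  show thesis
  proof (rule that)
    have "f = restrict (\<lambda>\<omega>. (1 - c) * restrict g {-pi..pi} \<omega> + c / (2 * pi)) {-pi..pi}"
      by (auto simp: f_def h_def fun_eq_iff restrict_def)
    moreover have "restrict g {-pi..pi} \<in> spec_AR2"
      unfolding g_def by (rule ar2_density_in_spec_AR2[OF \<rho> \<nu>])
    ultimately show "f \<in> spec_AR2_ext"
      unfolding spec_AR2_ext_def using c by (intro CollectI exI[of _ "1 - c"] exI[of _ "restrict g {-pi..pi}"] exI[of _ c]) auto
    show "transpose (Sigma_mat f :: real^'n::{finite,linorder}^'n::{finite,linorder}) = Sigma_mat f"
      by (rule transpose_Sigma_mat[OF f(1)])
    show "z \<bullet> (Sigma_mat f *v z) \<ge> 0" for z :: "real^'n::{finite,linorder}"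
      by (rule Sigma_mat_psd[OF f])
    fix j l :: 'n
    \<comment> \<open>The moment estimate is for natural lags, so the signed lag is replaced by its
      absolute value using that \<open>cos\<close> is even.\<close>
    define p where "p = int (pos j) - int (pos l)"
    have cosp: "cos (real (pos j) * \<omega> - real (pos l) * \<omega>) = cos (real (nat \<bar>p\<bar>) * \<omega>)" for \<omega>
    proof -
      have "real (pos j) * \<omega> - real (pos l) * \<omega> = real_of_int p * \<omega>"
        by (simp add: p_def algebra_simps)
      then show ?thesis by (cases "p \<ge> 0") simp_all
    qed
    have "Sigma_mat f $ j $ l = integral {-pi..pi} (\<lambda>\<omega>. cos (real (nat \<bar>p\<bar>) * \<omega>) * f \<omega>)"
      by (simp only: Sigma_mat_eq_integral[OF f(1)] cosp)
    also have "\<dots> = integral {-pi..pi} (\<lambda>\<omega>. (1 - c) * (cos (real (nat \<bar>p\<bar>) * \<omega>) * g \<omega>) +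
        c / (2 * pi) * cos (real_of_int \<bar>p\<bar> * \<omega>))"
      by (rule integral_cong) (auto simp: f_def h_def algebra_simps)
    also have "\<dots> = (1 - c) * integral {-pi..pi} (\<lambda>\<omega>. cos (real (nat \<bar>p\<bar>) * \<omega>) * g \<omega>) +
        c / (2 * pi) * integral {-pi..pi} (\<lambda>\<omega>. cos (real_of_int \<bar>p\<bar> * \<omega>))"
      by (subst integral_add) (auto intro!: integrable_continuous_real continuous_intros g)
    also have "c / (2 * pi) * integral {-pi..pi} (\<lambda>\<omega>. cos (real_of_int \<bar>p\<bar> * \<omega>)) = c * (if j = l then 1 else 0)"
      unfolding integral_cos_full_period by (simp add: p_def)
    finally have eq: "Sigma_mat f $ j $ l = (1 - c) * integral {-pi..pi} (\<lambda>\<omega>. cos (real (nat \<bar>p\<bar>) * \<omega>) * g \<omega>) +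
        c * (if j = l then 1 else 0)" .
    have "pos j \<in> {1..CARD('n)}" "pos l \<in> {1..CARD('n)}"
      using bij_betwE[OF bij_betw_pos[where 'a='n]] by auto
    then have "real (nat \<bar>p\<bar>) \<le> n" by (auto simp: p_def n_def)
    then have p: "(real (nat \<bar>p\<bar>))\<^sup>2 \<le> n\<^sup>2" by (intro power_mono) auto
    have "\<bar>integral {-pi..pi} (\<lambda>\<omega>. cos (real (nat \<bar>p\<bar>) * \<omega>) * g \<omega>) - cos (real (nat \<bar>p\<bar>) * \<nu>)\<bar>
        \<le> (real (nat \<bar>p\<bar>))\<^sup>2 * (70 * t)"
      unfolding g_def by (rule ar2_density_cos_moment_le[OF \<rho> \<nu> t(1,2) \<rho>_def])
    also have "\<dots> \<le> n\<^sup>2 * (70 * t)" using p t by (intro mult_right_mono) auto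
    also note t(3)
    finally have "(1 - c) * \<bar>integral {-pi..pi} (\<lambda>\<omega>. cos (real (nat \<bar>p\<bar>) * \<omega>) * g \<omega>) - cos (real (nat \<bar>p\<bar>) * \<nu>)\<bar>
        \<le> 1 * \<epsilon>"
      using c \<epsilon> by (intro mult_mono) auto
    then show "\<bar>Sigma_mat f $ j $ l - ((1 - c) * cos (real (pos j) * \<nu> - real (pos l) * \<nu>) +
        c * (if j = l then 1 else 0))\<bar> \<le> \<epsilon>"
      unfolding eq cosp using c by (simp add: abs_mult flip: right_diff_distrib)
  qed
qed


section \<open>Square roots of covariance matrices\<close>

text \<open>Along \<open>t *\<^sub>R axis p 1 + axis j 1\<close> the quadratic form is affine in
  \<open>t\<close>, and an affine function bounded below has slope 0.\<close>

lemma psd_zero_diagonal: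
  fixes A :: "real^'n^'n"
  assumes sym: "transpose A = A" and psd: "\<And>z. z \<bullet> (A *v z) \<ge> 0" and "A $ p $ p = 0"
  shows "A $ p $ j = 0"
proof (rule ccontr)
  assume nz: "A $ p $ j \<noteq> 0"
  have ent: "axis a 1 \<bullet> (A *v axis b 1) = A $ a $ b" for a b
    by (simp add: matrix_vector_mult_basis inner_axis' column_def)
  have "A $ j $ p = A $ p $ j" using sym by (metis transpose_def vec_lambda_beta)
  then have "0 \<le> 2 * t * A $ p $ j + A $ j $ j" for t
    using psd[of "t *\<^sub>R axis p 1 + axis j 1"] assms(3)
    by (simp add: matrix_vector_right_distrib matrix_vector_mult_scaleR inner_add_left inner_add_right ent)
  \<comment> \<open>At this \<open>t\<close> the affine function equals -1.\<close>
  from this[of "- (A $ j $ j + 1) / (2 * A $ p $ j)"] show False using nz by (simp add: field_simps)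
qed

text \<open>Elimination of one index per step, as in a Cholesky factorization. Confining the columns
  of \<open>B\<close> to \<open>I\<close> keeps column \<open>p\<close> free until it is needed. A
  zero pivot has a zero row by \<open>psd_zero_diagonal\<close>, so singular matrices are
  covered.\<close>

lemma ex_square_root_psd_supported:
  fixes A :: "real^'n^'n"
  assumes "finite I" "transpose A = A" "\<And>z. z \<bullet> (A *v z) \<ge> 0" "\<And>i j. A $ i $ j \<noteq> 0 \<Longrightarrow> i \<in> I"
  shows "\<exists>B :: real^'n^'n. (\<forall>i k. B $ i $ k \<noteq> 0 \<longrightarrow> k \<in> I) \<and> B ** transpose B = A"
  using assms
proof (induction I arbitrary: A rule: finite_induct)
  case empty
  then have "A $ i $ j = 0" for i j by blast
  then have "A = 0" by (simp add: vec_eq_iff)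
  then show ?case by (intro exI[of _ 0]) (simp add: matrix_matrix_mult_def vec_eq_iff)
next
  case (insert p I)
  have sym: "A $ i $ j = A $ j $ i" for i j
    using insert.prems(1) by (metis transpose_def vec_lambda_beta)
  show ?case
  proof (cases "A $ p $ p = 0")
    case True
    have "\<exists>B :: real^'n^'n. (\<forall>i k. B $ i $ k \<noteq> 0 \<longrightarrow> k \<in> I) \<and> B ** transpose B = A"
    proof (rule insert.IH[OF insert.prems(1,2)])
      show "i \<in> I" if "A $ i $ j \<noteq> 0" for i j
        using insert.prems(3)[OF that] psd_zero_diagonal[OF insert.prems(1,2) True] that by auto
    qed
    then show ?thesis by blast
  next
    case False
    define d where "d = A $ p $ p"
    define a where "a = A *v axis p 1"
    have a: "a $ i = A $ i $ p" for i by (simp add: a_def matrix_vector_mult_basis column_def)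
    have "0 \<le> d"
      using insert.prems(2)[of "axis p 1"] by (simp add: d_def inner_axis' matrix_vector_mult_basis column_def)
    then have d: "d > 0" using False by (simp add: d_def)
    \<comment> \<open>The Schur complement of the pivot: a rank one matrix is subtracted so that row
      \<open>p\<close> disappears.\<close>
    define A' :: "real^'n^'n" where "A' = (\<chi> i j. A $ i $ j - a $ i * a $ j / d)"
    have A'z: "A' *v z = A *v z - ((a \<bullet> z) / d) *\<^sub>R a" for z
      by (simp add: A'_def vec_eq_iff matrix_vector_mult_def inner_vec_def right_diff_distrib
          sum_subtractf sum_divide_distrib sum_distrib_left mult_ac)
    have "\<exists>B :: real^'n^'n. (\<forall>i k. B $ i $ k \<noteq> 0 \<longrightarrow> k \<in> I) \<and> B ** transpose B = A'"
    proof (rule insert.IH)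
      show "transpose A' = A'"
        by (simp add: transpose_def A'_def vec_eq_iff sym mult.commute)
      show "z \<bullet> (A' *v z) \<ge> 0" for z
      proof -
        define c where "c = (a \<bullet> z) / d"
        have pz: "axis p 1 \<bullet> (A *v z) = a \<bullet> z"
          unfolding a_def using inner_matrix_vector_transpose[of "axis p 1" A z] insert.prems(1) by simp
        have pp: "axis p 1 \<bullet> a = d" by (simp add: inner_axis' a d_def)
        have "0 \<le> (z - c *\<^sub>R axis p 1) \<bullet> (A *v (z - c *\<^sub>R axis p 1))" by (rule insert.prems(2))
        also have "\<dots> = z \<bullet> (A *v z) - 2 * c * (a \<bullet> z) + c\<^sup>2 * d"
          by (simp add: matrix_vector_mult_diff_distrib matrix_vector_mult_scaleR inner_diff_left
              inner_diff_right pz pp a_def[symmetric] inner_commute[of z a] power2_eq_square algebra_simps)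
        also have "\<dots> = z \<bullet> (A' *v z)"
          using d by (simp add: A'z inner_diff_right c_def inner_commute[of z a] field_simps power2_eq_square)
        finally show ?thesis .
      qed
      show "i \<in> I" if "A' $ i $ j \<noteq> 0" for i j
      proof -
        have "i \<noteq> p"
        proof
          assume "i = p"
          then have "A' $ i $ j = 0" using d by (simp add: A'_def a d_def sym[of j p])
          with that show False by simp
        qed
        moreover have "A $ i $ j \<noteq> 0 \<or> A $ i $ p \<noteq> 0" using that by (auto simp: A'_def a)
        ultimately show ?thesis using insert.prems(3) by blast
      qed
    qed
    then obtain B :: "real^'n^'n" where B: "\<And>i k. B $ i $ k \<noteq> 0 \<Longrightarrow> k \<in> I" "B ** transpose B = A'"
      by blast
    define B' :: "real^'n^'n" where "B' = (\<chi> i k. if k = p then a $ i / sqrt d else B $ i $ k)"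
    have "(B' ** transpose B') $ i $ j = A $ i $ j" for i j
    proof -
      have "B $ i $ p = 0" using B(1) insert.hyps(2) by blast
      have "A' $ i $ j = (\<Sum>k\<in>UNIV. B $ i $ k * B $ j $ k)"
        unfolding B(2)[symmetric] by (simp add: matrix_matrix_mult_def transpose_def)
      also have "\<dots> = (\<Sum>k\<in>UNIV - {p}. B $ i $ k * B $ j $ k)"
        using \<open>B $ i $ p = 0\<close> by (subst sum.remove[of _ p]) auto
      finally have "A' $ i $ j = (\<Sum>k\<in>UNIV - {p}. B $ i $ k * B $ j $ k)" .
      moreover have "(B' ** transpose B') $ i $ j = B' $ i $ p * B' $ j $ p + (\<Sum>k\<in>UNIV - {p}. B' $ i $ k * B' $ j $ k)"
        by (simp add: matrix_matrix_mult_def transpose_def sum.remove[of _ p])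
      moreover have "(\<Sum>k\<in>UNIV - {p}. B' $ i $ k * B' $ j $ k) = (\<Sum>k\<in>UNIV - {p}. B $ i $ k * B $ j $ k)"
        by (rule sum.cong) (auto simp: B'_def)
      moreover have "B' $ i $ p * B' $ j $ p = a $ i * a $ j / d"
        using d by (simp add: B'_def)
      ultimately show ?thesis by (simp add: A'_def)
    qed
    then show ?thesis using B(1)
      by (intro exI[of _ B']) (auto simp: vec_eq_iff B'_def)
  qed
qed

text \<open>Guarantees that the choice inside \<open>gaussian\<close> denotes a genuine square
  root.\<close>

lemma ex_square_root_psd:
  fixes A :: "real^'n^'n"
  assumes "transpose A = A" "\<And>z. z \<bullet> (A *v z) \<ge> 0"
  shows "\<exists>B :: real^'n^'n. B ** transpose B = A"
  using ex_square_root_psd_supported[OF finite assms, of UNIV] by auto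


section \<open>Low-frequency asymptotics\<close>

text \<open>Expanding each \<open>cis (p i * \<nu>)\<close> to order \<open>P\<close> and
  interchanging sums, the coefficient of \<open>\<nu> ^ k\<close> is a multiple of the k-th moment,
  so only order \<open>P\<close> survives. The factorial in the remainder is dropped.\<close>

lemma cmod_trig_sum_minus_moment_le:
  fixes g p :: "'i \<Rightarrow> real"
  assumes "\<And>q. q < P \<Longrightarrow> (\<Sum>i\<in>I. g i * p i ^ q) = 0"
  shows "cmod ((\<Sum>i\<in>I. of_real (g i) * cis (p i * \<nu>)) -
      (\<i> * of_real \<nu>) ^ P / fact P * of_real (\<Sum>i\<in>I. g i * p i ^ P))
    \<le> (\<Sum>i\<in>I. \<bar>g i\<bar> * \<bar>p i\<bar> ^ Suc P) * \<bar>\<nu>\<bar> ^ Suc P"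
proof -
  define T where "T x = (\<Sum>k\<le>P. (\<i> * of_real x) ^ k / fact k)" for x :: real
  have "(\<Sum>i\<in>I. of_real (g i) * T (p i * \<nu>)) =
      (\<Sum>k\<le>P. (\<i> * of_real \<nu>) ^ k / fact k * of_real (\<Sum>i\<in>I. g i * p i ^ k))"
    unfolding T_def sum_distrib_left of_real_sum
    by (subst sum.swap) (simp add: power_mult_distrib mult_ac)
  also have "\<dots> = (\<Sum>k\<in>{P}. (\<i> * of_real \<nu>) ^ k / fact k * of_real (\<Sum>i\<in>I. g i * p i ^ k))"
    using assms by (intro sum.mono_neutral_right) auto
  finally have "(\<Sum>i\<in>I. of_real (g i) * cis (p i * \<nu>)) - (\<i> * of_real \<nu>) ^ P / fact P * of_real (\<Sum>i\<in>I. g i * p i ^ P)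
      = (\<Sum>i\<in>I. of_real (g i) * (cis (p i * \<nu>) - T (p i * \<nu>)))"
    by (simp add: right_diff_distrib sum_subtractf)
  also have "cmod \<dots> \<le> (\<Sum>i\<in>I. \<bar>g i\<bar> * (\<bar>p i\<bar> ^ Suc P * \<bar>\<nu>\<bar> ^ Suc P))"
  proof (rule sum_norm_le)
    fix i
    have "cmod (cis (p i * \<nu>) - T (p i * \<nu>)) \<le> \<bar>p i * \<nu>\<bar> ^ Suc P / fact (Suc P)"
      using iexp_approx1[of "p i * \<nu>" P] by (simp add: cis_conv_exp T_def)
    also have "\<dots> \<le> \<bar>p i * \<nu>\<bar> ^ Suc P / 1"
      by (intro divide_left_mono) (auto simp: fact_ge_1 simp del: fact_Suc)
    finally have "cmod (cis (p i * \<nu>) - T (p i * \<nu>)) \<le> \<bar>p i\<bar> ^ Suc P * \<bar>\<nu>\<bar> ^ Suc P"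
      by (simp add: abs_mult power_mult_distrib del: power_Suc)
    then show "cmod (of_real (g i) * (cis (p i * \<nu>) - T (p i * \<nu>))) \<le> \<bar>g i\<bar> * (\<bar>p i\<bar> ^ Suc P * \<bar>\<nu>\<bar> ^ Suc P)"
      unfolding norm_mult by (intro mult_mono) auto
  qed
  finally show ?thesis by (simp add: sum_distrib_right mult.assoc)
qed

lemma cmod_trig_sum_le:
  fixes g p :: "'i \<Rightarrow> real"
  assumes "\<And>q. q < P \<Longrightarrow> (\<Sum>i\<in>I. g i * p i ^ q) = 0"
  shows "\<exists>C\<ge>0. \<forall>\<nu>. \<bar>\<nu>\<bar> \<le> 1 \<longrightarrow> cmod (\<Sum>i\<in>I. of_real (g i) * cis (p i * \<nu>)) \<le> C * \<bar>\<nu>\<bar> ^ P"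
proof -
  define D where "D = (\<Sum>i\<in>I. \<bar>g i\<bar> * \<bar>p i\<bar> ^ Suc P)"
  define m where "m = (\<Sum>i\<in>I. g i * p i ^ P)"
  have D: "D \<ge> 0" by (simp add: D_def sum_nonneg)
  have "cmod (\<Sum>i\<in>I. of_real (g i) * cis (p i * \<nu>)) \<le> (D + \<bar>m\<bar> / fact P) * \<bar>\<nu>\<bar> ^ P" if "\<bar>\<nu>\<bar> \<le> 1" for \<nu>
  proof -
    have "cmod ((\<Sum>i\<in>I. of_real (g i) * cis (p i * \<nu>)) - (\<i> * of_real \<nu>) ^ P / fact P * of_real m)
        \<le> D * \<bar>\<nu>\<bar> ^ Suc P"
      unfolding D_def m_def by (rule cmod_trig_sum_minus_moment_le) (rule assms)
    then have "cmod (\<Sum>i\<in>I. of_real (g i) * cis (p i * \<nu>)) \<le>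
        D * \<bar>\<nu>\<bar> ^ Suc P + cmod ((\<i> * of_real \<nu>) ^ P / fact P * of_real m)"
      using norm_triangle_sub[of "\<Sum>i\<in>I. of_real (g i) * cis (p i * \<nu>)" "(\<i> * of_real \<nu>) ^ P / fact P * of_real m"]
      by linarith
    also have "cmod ((\<i> * of_real \<nu>) ^ P / fact P * of_real m) = \<bar>m\<bar> / fact P * \<bar>\<nu>\<bar> ^ P"
      by (simp add: norm_mult norm_divide norm_power)
    also have "D * \<bar>\<nu>\<bar> ^ Suc P \<le> D * \<bar>\<nu>\<bar> ^ P"
      using D that by (intro mult_left_mono power_decreasing) auto
    finally show ?thesis by (simp add: distrib_right)
  qed
  moreover have "D + \<bar>m\<bar> / fact P \<ge> 0" using D by simp
  ultimately show ?thesis by blast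
qed

text \<open>The first nonzero moment gives the exact order of vanishing, once \<nu> is so small that
  the remainder takes at most half of the leading term.\<close>

lemma cmod_trig_sum_ge:
  fixes g p :: "'i \<Rightarrow> real"
  assumes "\<And>q. q < P \<Longrightarrow> (\<Sum>i\<in>I. g i * p i ^ q) = 0" "(\<Sum>i\<in>I. g i * p i ^ P) \<noteq> 0"
  shows "\<exists>\<alpha>>0. \<exists>\<delta>>0. \<forall>\<nu>. 0 < \<nu> \<longrightarrow> \<nu> \<le> \<delta> \<longrightarrow>
    \<alpha> * \<nu> ^ P \<le> cmod (\<Sum>i\<in>I. of_real (g i) * cis (p i * \<nu>))"
proof -
  define D where "D = (\<Sum>i\<in>I. \<bar>g i\<bar> * \<bar>p i\<bar> ^ Suc P)"
  define m where "m = (\<Sum>i\<in>I. g i * p i ^ P)"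
  define \<alpha> where "\<alpha> = \<bar>m\<bar> / fact P / 2"
  have D: "D \<ge> 0" by (simp add: D_def sum_nonneg)
  have \<alpha>: "\<alpha> > 0" using assms(2) by (simp add: \<alpha>_def m_def)
  \<comment> \<open>\<alpha> is half the leading coefficient, and the range of \<nu> makes the
    remainder at most the other half; \<open>D + 1\<close> replaces \<open>D\<close>, which may be
    0.\<close>
  have "\<alpha> * \<nu> ^ P \<le> cmod (\<Sum>i\<in>I. of_real (g i) * cis (p i * \<nu>))"
    if \<nu>: "0 < \<nu>" "\<nu> \<le> \<alpha> / (D + 1)" for \<nu>
  proof -
    have "D * \<nu> \<le> (D + 1) * \<nu>" using \<nu> by simp
    also have "\<dots> \<le> \<alpha>" using \<nu> D by (simp add: field_simps)
    finally have "D * \<nu> * \<nu> ^ P \<le> \<alpha> * \<nu> ^ P" using \<nu> by (intro mult_right_mono) auto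
    moreover have "cmod ((\<i> * of_real \<nu>) ^ P / fact P * of_real m) = 2 * \<alpha> * \<nu> ^ P"
      using \<nu> by (simp add: norm_mult norm_divide norm_power \<alpha>_def)
    moreover have "cmod ((\<Sum>i\<in>I. of_real (g i) * cis (p i * \<nu>)) - (\<i> * of_real \<nu>) ^ P / fact P * of_real m)
        \<le> D * \<bar>\<nu>\<bar> ^ Suc P"
      unfolding D_def m_def by (rule cmod_trig_sum_minus_moment_le) (rule assms(1))
    then have "cmod ((\<i> * of_real \<nu>) ^ P / fact P * of_real m) \<le>
        cmod (\<Sum>i\<in>I. of_real (g i) * cis (p i * \<nu>)) + D * \<bar>\<nu>\<bar> ^ Suc P"
      using norm_triangle_sub[of "(\<i> * of_real \<nu>) ^ P / fact P * of_real m" "\<Sum>i\<in>I. of_real (g i) * cis (p i * \<nu>)"]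
        norm_minus_commute[of "\<Sum>i\<in>I. of_real (g i) * cis (p i * \<nu>)" "(\<i> * of_real \<nu>) ^ P / fact P * of_real m"]
      by linarith
    moreover have "D * \<bar>\<nu>\<bar> ^ Suc P = D * \<nu> * \<nu> ^ P" using \<nu> by simp
    ultimately show ?thesis by linarith
  qed
  moreover have "\<alpha> / (D + 1) > 0" using \<alpha> D by simp
  ultimately show ?thesis using \<alpha> by blast
qed

text \<open>The discrete Fourier transform at frequency \<nu>. The cosine matrix is a bilinear form
  in it, of rank at most two.\<close>

definition trig_transform :: "real^'n::{finite,linorder} \<Rightarrow> real \<Rightarrow> complex" where
  "trig_transform a \<nu> = (\<Sum>i\<in>UNIV. of_real (a $ i) * cis (real (pos i) * \<nu>))"

lemma sum_cos_eq_trig_transform: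
  fixes a b :: "real^'n::{finite,linorder}"
  shows "(\<Sum>i\<in>UNIV. \<Sum>j\<in>UNIV. a $ i * cos (real (pos i) * \<nu> - real (pos j) * \<nu>) * b $ j) =
    Re (trig_transform a \<nu> * cnj (trig_transform b \<nu>))"
  by (simp add: trig_transform_def cos_diff sum_product sum.distrib[symmetric] algebra_simps)

lemma quadratic_form_near_cosine:
  fixes a b :: "real^'n::{finite,linorder}" and S :: "real^'n::{finite,linorder}^'n::{finite,linorder}"
  assumes "\<And>j l. \<bar>S $ j $ l - ((1 - c) * cos (real (pos j) * \<nu> - real (pos l) * \<nu>) +
        c * (if j = l then 1 else 0))\<bar> \<le> \<epsilon>"
  shows "\<bar>a \<bullet> (S *v b) - ((1 - c) * Re (trig_transform a \<nu> * cnj (trig_transform b \<nu>)) + c * (a \<bullet> b))\<bar>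
    \<le> \<epsilon> * ((\<Sum>i\<in>UNIV. \<bar>a $ i\<bar>) * (\<Sum>j\<in>UNIV. \<bar>b $ j\<bar>))"
proof -
  define k where "k j l = cos (real (pos j) * \<nu> - real (pos l) * \<nu>)" for j l :: 'n
  define e where "e j l = S $ j $ l - ((1 - c) * k j l + c * (if j = l then 1 else 0))" for j l
  have "a \<bullet> (S *v b) = (\<Sum>j\<in>UNIV. \<Sum>l\<in>UNIV. a $ j * S $ j $ l * b $ l)"
    by (simp add: inner_vec_def matrix_vector_mult_def sum_distrib_left mult.assoc)
  also have "\<dots> = (\<Sum>j\<in>UNIV. \<Sum>l\<in>UNIV. a $ j * e j l * b $ l + (1 - c) * (a $ j * k j l * b $ l) +
      c * (if j = l then a $ j * b $ l else 0))"
    by (intro sum.cong refl) (simp add: e_def algebra_simps)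
  also have "\<dots> = (\<Sum>j\<in>UNIV. \<Sum>l\<in>UNIV. a $ j * e j l * b $ l) +
      (1 - c) * (\<Sum>j\<in>UNIV. \<Sum>l\<in>UNIV. a $ j * k j l * b $ l) + c * (a \<bullet> b)"
    by (simp add: sum.distrib sum_distrib_left[symmetric] inner_vec_def del: mult_eq_0_iff)
  finally have "a \<bullet> (S *v b) - ((1 - c) * Re (trig_transform a \<nu> * cnj (trig_transform b \<nu>)) + c * (a \<bullet> b)) =
      (\<Sum>j\<in>UNIV. \<Sum>l\<in>UNIV. a $ j * e j l * b $ l)"
    unfolding k_def sum_cos_eq_trig_transform by simp
  also have "\<bar>\<dots>\<bar> \<le> (\<Sum>j\<in>UNIV. \<Sum>l\<in>UNIV. \<bar>a $ j * e j l * b $ l\<bar>)"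
    by (rule order_trans[OF sum_abs sum_mono]) (rule sum_abs)
  also have "\<dots> \<le> (\<Sum>j\<in>UNIV. \<Sum>l\<in>UNIV. \<epsilon> * (\<bar>a $ j\<bar> * \<bar>b $ l\<bar>))"
  proof (intro sum_mono)
    fix j l
    have "\<bar>e j l\<bar> * (\<bar>a $ j\<bar> * \<bar>b $ l\<bar>) \<le> \<epsilon> * (\<bar>a $ j\<bar> * \<bar>b $ l\<bar>)"
      using assms[of j l] by (intro mult_right_mono) (auto simp: e_def k_def)
    then show "\<bar>a $ j * e j l * b $ l\<bar> \<le> \<epsilon> * (\<bar>a $ j\<bar> * \<bar>b $ l\<bar>)"
      by (simp add: abs_mult mult_ac)
  qed
  also have "\<dots> = \<epsilon> * ((\<Sum>i\<in>UNIV. \<bar>a $ i\<bar>) * (\<Sum>j\<in>UNIV. \<bar>b $ j\<bar>))"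
    unfolding sum_product by (simp add: sum_distrib_left)
  finally show ?thesis .
qed

text \<open>
  The weight \<open>\<nu> ^ (2 K - 1)\<close> of the white noise component dominates the \<open>\<nu> ^ (2 K)\<close> that the
  cosine leaves behind after the first \<open>K\<close> moments have been removed, but is dominated by the
  contribution of a nonzero moment of order less than \<open>K\<close>.
\<close>

lemma ex_concentrating_spec_AR2_ext:
  fixes Q :: "real^'n::{finite,linorder}^'n::{finite,linorder}" and h :: "real^'n::{finite,linorder}"
  assumes Q: "\<And>s q. q < K \<Longrightarrow> (\<Sum>t\<in>UNIV. Q $ s $ t * real (pos t) ^ q) = 0"
    and h: "\<And>q. q < P \<Longrightarrow> (\<Sum>t\<in>UNIV. h $ t * real (pos t) ^ q) = 0"
      "(\<Sum>t\<in>UNIV. h $ t * real (pos t) ^ P) \<noteq> 0" and "P < K"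
  obtains f :: "nat \<Rightarrow> real \<Rightarrow> real" and c :: "nat \<Rightarrow> real"
    where "\<And>m. f m \<in> spec_AR2_ext" "\<And>m. c m > 0"
      "\<And>m. transpose (Sigma_mat (f m) :: real^'n::{finite,linorder}^'n::{finite,linorder}) = Sigma_mat (f m)"
      "\<And>m (z :: real^'n::{finite,linorder}). z \<bullet> (Sigma_mat (f m) *v z) \<ge> 0"
      "(\<lambda>m. (1 / c m) *\<^sub>R (Q ** Sigma_mat (f m) ** transpose Q)) \<longlonglongrightarrow> Q ** transpose Q"
      "filterlim (\<lambda>m. (h \<bullet> (Sigma_mat (f m) *v h)) / c m) at_top sequentially"
proof -
  \<comment> \<open>The shift by 2 keeps \<nu>, and with it the weight \<open>c\<close>, at most
    \<open>1 / 2\<close>, so the cosine part retains at least half of its weight.\<close>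
  define \<nu> where "\<nu> m = 1 / (real m + 2)" for m
  have \<nu>: "0 < \<nu> m" "\<nu> m \<le> 1 / 2" "\<nu> m < 1" for m by (auto simp: \<nu>_def field_simps)
  have \<nu>0: "\<nu> \<longlonglongrightarrow> 0" unfolding \<nu>_def by real_asymp
  define c where "c m = \<nu> m ^ (2 * K - 1)" for m
  have c: "0 < c m" "c m \<le> 1 / 2" for m
  proof -
    show "0 < c m" using \<nu>[of m] by (simp add: c_def)
    have "c m \<le> \<nu> m ^ 1" unfolding c_def using \<nu>[of m] \<open>P < K\<close> by (intro power_decreasing) auto
    then show "c m \<le> 1 / 2" using \<nu>[of m] by simp
  qed
  have c\<nu>: "\<nu> m ^ (2 * K) = c m * \<nu> m" for m
    using \<open>P < K\<close> by (simp add: c_def flip: power_Suc2)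
  \<comment> \<open>The tolerance \<open>c m * \<nu> m\<close> still tends to 0 after division by
    \<open>c m\<close>.\<close>
  define good :: "nat \<Rightarrow> (real \<Rightarrow> real) \<Rightarrow> bool" where "good m f \<longleftrightarrow> f \<in> spec_AR2_ext \<and>
      transpose (Sigma_mat f :: real^'n::{finite,linorder}^'n::{finite,linorder}) = Sigma_mat f \<and>
      (\<forall>z :: real^'n::{finite,linorder}. z \<bullet> (Sigma_mat f *v z) \<ge> 0) \<and>
      (\<forall>j l :: 'n. \<bar>Sigma_mat f $ j $ l - ((1 - c m) * cos (real (pos j) * \<nu> m - real (pos l) * \<nu> m) +
        c m * (if j = l then 1 else 0))\<bar> \<le> c m * \<nu> m)" for m f
  have "\<exists>f. good m f" for m
  proof -
    have "0 < c m * \<nu> m" "0 \<le> c m" "c m \<le> 1"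
      using \<nu>[of m] c[of m] by auto
    then show ?thesis
    proof (rule ex_spec_AR2_ext_near_cosine[where \<epsilon>="c m * \<nu> m" and c="c m" and \<nu>="\<nu> m" and 'n='n,
          OF \<nu>(1,3)], goal_cases)
      case (1 f)
      have "good m f" unfolding good_def by (intro conjI allI 1)
      then show ?case by blast
    qed
  qed
  then obtain f where good: "\<And>m. good m (f m)" by metis
  note f = good[unfolded good_def, THEN conjunct1]
    good[unfolded good_def, THEN conjunct2, THEN conjunct1]
    good[unfolded good_def, THEN conjunct2, THEN conjunct2, THEN conjunct1, rule_format]
    good[unfolded good_def, THEN conjunct2, THEN conjunct2, THEN conjunct2, rule_format]
  note near = quadratic_form_near_cosine[OF f(4)]
  show thesis
  proof (rule that[OF f(1) c(1) f(2,3)])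
    have "(\<lambda>m. ((1 / c m) *\<^sub>R (Q ** Sigma_mat (f m) ** transpose Q)) $ s $ r) \<longlonglongrightarrow> (Q ** transpose Q) $ s $ r" for s r
    proof -
      define a b where "a = Q $ s" and "b = Q $ r"
      have ent: "(Q ** Sigma_mat (f m) ** transpose Q) $ s $ r = a \<bullet> (Sigma_mat (f m) *v b)" for m
      proof -
        have "(Q ** Sigma_mat (f m) ** transpose Q) $ s $ r =
            (\<Sum>l\<in>UNIV. \<Sum>j\<in>UNIV. a $ j * Sigma_mat (f m) $ j $ l * b $ l)"
          by (simp add: matrix_matrix_mult_def transpose_def a_def b_def sum_distrib_right)
        also have "\<dots> = (\<Sum>j\<in>UNIV. \<Sum>l\<in>UNIV. a $ j * Sigma_mat (f m) $ j $ l * b $ l)"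
          by (rule sum.swap)
        finally show ?thesis
          by (simp add: inner_vec_def matrix_vector_mult_def sum_distrib_left mult.assoc)
      qed
      have ab: "(Q ** transpose Q) $ s $ r = a \<bullet> b"
        by (simp add: matrix_matrix_mult_def transpose_def a_def b_def inner_vec_def)
      have "\<exists>C\<ge>0. \<forall>x. \<bar>x\<bar> \<le> 1 \<longrightarrow> cmod (trig_transform a x) \<le> C * \<bar>x\<bar> ^ K"
        unfolding trig_transform_def by (rule cmod_trig_sum_le) (simp add: a_def Q)
      then obtain C1 where C1: "C1 \<ge> 0" "\<And>x. \<bar>x\<bar> \<le> 1 \<Longrightarrow> cmod (trig_transform a x) \<le> C1 * \<bar>x\<bar> ^ K"
        by blast
      have "\<exists>C\<ge>0. \<forall>x. \<bar>x\<bar> \<le> 1 \<longrightarrow> cmod (trig_transform b x) \<le> C * \<bar>x\<bar> ^ K"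
        unfolding trig_transform_def by (rule cmod_trig_sum_le) (simp add: b_def Q)
      then obtain C2 where C2: "C2 \<ge> 0" "\<And>x. \<bar>x\<bar> \<le> 1 \<Longrightarrow> cmod (trig_transform b x) \<le> C2 * \<bar>x\<bar> ^ K"
        by blast
      define D where "D = (\<Sum>i\<in>UNIV. \<bar>a $ i\<bar>) * (\<Sum>j\<in>UNIV. \<bar>b $ j\<bar>)"
      \<comment> \<open>Each of the two transforms contributes \<open>\<nu> m ^ K\<close>, and
        \<open>\<nu> m ^ (2 * K)\<close> is \<open>c m * \<nu> m\<close>: one power of
        \<open>\<nu> m\<close> is left over after division by \<open>c m\<close>.\<close>
      have bound: "norm ((a \<bullet> (Sigma_mat (f m) *v b)) / c m - a \<bullet> b) \<le> (D + C1 * C2) * \<nu> m" for m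
      proof -
        let ?z = "trig_transform a (\<nu> m) * cnj (trig_transform b (\<nu> m))"
        have "\<bar>Re ?z\<bar> \<le> cmod (trig_transform a (\<nu> m)) * cmod (trig_transform b (\<nu> m))"
          using abs_Re_le_cmod[of ?z] by (simp add: norm_mult)
        also have "\<dots> \<le> (C1 * \<nu> m ^ K) * (C2 * \<nu> m ^ K)"
          using C1(2)[of "\<nu> m"] C2(2)[of "\<nu> m"] \<nu>[of m] C1(1) by (intro mult_mono) auto
        also have "\<dots> = C1 * C2 * (c m * \<nu> m)"
          by (simp add: c\<nu>[symmetric] mult_2 power_add)
        finally have "\<bar>Re ?z\<bar> \<le> C1 * C2 * (c m * \<nu> m)" .
        then have "(1 - c m) * \<bar>Re ?z\<bar> \<le> 1 * (C1 * C2 * (c m * \<nu> m))"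
          using c[of m] by (intro mult_mono) auto
        then have "\<bar>(1 - c m) * Re ?z\<bar> \<le> C1 * C2 * (c m * \<nu> m)"
          using c[of m] by (simp add: abs_mult)
        then have "\<bar>a \<bullet> (Sigma_mat (f m) *v b) - c m * (a \<bullet> b)\<bar> \<le> (c m * \<nu> m) * D + C1 * C2 * (c m * \<nu> m)"
          using near[of a m b] unfolding D_def by linarith
        then have "\<bar>a \<bullet> (Sigma_mat (f m) *v b) - c m * (a \<bullet> b)\<bar> / c m \<le> (D + C1 * C2) * \<nu> m"
          using c[of m] by (simp add: field_simps)
        moreover have "(a \<bullet> (Sigma_mat (f m) *v b)) / c m - a \<bullet> b =
            (a \<bullet> (Sigma_mat (f m) *v b) - c m * (a \<bullet> b)) / c m"
          using c(1)[of m] by (simp add: diff_divide_distrib)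
        ultimately show ?thesis
          using c(1)[of m] by (simp only: real_norm_def abs_divide abs_of_pos)
      qed
      have "(\<lambda>m. (D + C1 * C2) * \<nu> m) \<longlonglongrightarrow> 0"
        using tendsto_mult_right_zero[OF \<nu>0] by simp
      then have "(\<lambda>m. (a \<bullet> (Sigma_mat (f m) *v b)) / c m - a \<bullet> b) \<longlonglongrightarrow> 0"
        by (rule Lim_null_comparison[rotated]) (use bound in auto)
      then show ?thesis
        unfolding ab by (simp add: ent LIM_zero_iff)
    qed
    then show "(\<lambda>m. (1 / c m) *\<^sub>R (Q ** Sigma_mat (f m) ** transpose Q)) \<longlonglongrightarrow> Q ** transpose Q"
      by (intro vec_tendstoI)
  next
    have "\<exists>\<alpha>>0. \<exists>\<delta>>0. \<forall>x. 0 < x \<longrightarrow> x \<le> \<delta> \<longrightarrow> \<alpha> * x ^ P \<le> cmod (trig_transform h x)"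
      unfolding trig_transform_def by (rule cmod_trig_sum_ge) (use h in simp_all)
    then obtain \<alpha> \<delta> where \<alpha>: "\<alpha> > 0" "\<delta> > 0"
        and lower: "\<And>x. 0 < x \<Longrightarrow> x \<le> \<delta> \<Longrightarrow> \<alpha> * x ^ P \<le> cmod (trig_transform h x)"
      by blast
    define D where "D = (\<Sum>i\<in>UNIV. \<bar>h $ i\<bar>) * (\<Sum>j\<in>UNIV. \<bar>h $ j\<bar>)"
    \<comment> \<open>From \<open>P \<le> K - 1\<close>, the signal \<open>\<nu> m ^ (2 * P)\<close>
      is at least \<open>\<nu> m ^ (2 * K - 2) = c m / \<nu> m\<close>, one power of
      \<open>\<nu> m\<close> larger than the weight.\<close>
    have bound: "\<alpha>\<^sup>2 / 2 * (1 / \<nu> m) - \<nu> m * D \<le> (h \<bullet> (Sigma_mat (f m) *v h)) / c m" if "\<nu> m \<le> \<delta>" for m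
    proof -
      let ?z = "trig_transform h (\<nu> m)"
      have "c m = \<nu> m ^ (2 * (K - 1)) * \<nu> m"
        using \<open>P < K\<close> by (simp add: c_def Suc_diff_Suc numeral_2_eq_2 flip: power_Suc2)
      moreover have "\<nu> m ^ (2 * (K - 1)) \<le> \<nu> m ^ (2 * P)"
        using \<open>P < K\<close> \<nu>[of m] by (intro power_decreasing) auto
      ultimately have "c m / \<nu> m \<le> (\<nu> m ^ P)\<^sup>2"
        using \<nu>[of m] by (simp add: power_mult mult.commute)
      then have "\<alpha>\<^sup>2 * (c m / \<nu> m) \<le> (\<alpha> * \<nu> m ^ P)\<^sup>2"
        unfolding power_mult_distrib by (intro mult_left_mono) auto
      also have "\<dots> \<le> (cmod ?z)\<^sup>2"
        using lower[of "\<nu> m"] that \<nu>[of m] \<alpha>(1) by (intro power_mono) auto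
      also have "\<dots> = Re (?z * cnj ?z)"
        by (simp add: complex_mult_cnj cmod_power2)
      finally have "\<alpha>\<^sup>2 * (c m / \<nu> m) \<le> Re (?z * cnj ?z)" .
      then have "(1 / 2) * (\<alpha>\<^sup>2 * (c m / \<nu> m)) \<le> (1 - c m) * Re (?z * cnj ?z)"
        using c[of m] \<nu>[of m] by (intro mult_mono) auto
      moreover have "0 \<le> c m * (h \<bullet> h)" using c[of m] by simp
      ultimately have "(1 / 2) * (\<alpha>\<^sup>2 * (c m / \<nu> m)) - (c m * \<nu> m) * D \<le> h \<bullet> (Sigma_mat (f m) *v h)"
        using near[of h m h] unfolding D_def by linarith
      then show ?thesis using c[of m] by (simp add: field_simps)
    qed
    have "filterlim (\<lambda>m. \<alpha>\<^sup>2 / 2 * (1 / \<nu> m) - \<nu> m * D) at_top sequentially"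
      unfolding \<nu>_def using \<alpha>(1) by real_asymp
    moreover have "\<forall>\<^sub>F m in sequentially. \<nu> m \<le> \<delta>"
      using order_tendstoD(2)[OF \<nu>0 \<alpha>(2)] by eventually_elim simp
    then have "\<forall>\<^sub>F m in sequentially. \<alpha>\<^sup>2 / 2 * (1 / \<nu> m) - \<nu> m * D \<le> (h \<bullet> (Sigma_mat (f m) *v h)) / c m"
      by eventually_elim (rule bound)
    ultimately show "filterlim (\<lambda>m. (h \<bullet> (Sigma_mat (f m) *v h)) / c m) at_top sequentially"
      by (rule filterlim_at_top_mono)
  qed
qed


section \<open>Gaussian measures\<close>

lemma prod_Basis_cart: "(\<Prod>b\<in>Basis. g (b :: real^'n)) = (\<Prod>i\<in>UNIV. g (axis i 1))"
proof -
  have B: "(Basis :: (real^'n) set) = range (\<lambda>i. axis i 1)"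
    by (auto simp: Basis_vec_def)
  have "inj (\<lambda>i::'n. axis i (1::real))"
    by (simp add: inj_def axis_eq_axis)
  then show ?thesis
    unfolding B by (simp only: prod.reindex o_def)
qed

lemma prob_space_std_gaussian: "prob_space (std_gaussian :: (real^'n) measure)"
proof
  have "(\<integral>\<^sup>+x. ennreal (std_normal_density x) \<partial>lborel) = 1"
    using prob_space.emeasure_space_1[OF prob_space_normal_density[of 1 0]]
    by (simp add: emeasure_density)
  then have "1 = (\<integral>\<^sup>+z. (\<Prod>b\<in>(Basis :: (real^'n) set). ennreal (std_normal_density (z \<bullet> b))) \<partial>lborel)"
    by (subst nn_integral_lborel_prod) auto
  also have "\<dots> = (\<integral>\<^sup>+z. ennreal (\<Prod>i\<in>UNIV. std_normal_density ((z :: real^'n) $ i)) \<partial>lborel)"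
    by (simp add: prod_Basis_cart inner_axis prod_ennreal)
  also have "\<dots> = emeasure std_gaussian (space (std_gaussian :: (real^'n) measure))"
    by (simp add: std_gaussian_def emeasure_density)
  finally show "emeasure std_gaussian (space (std_gaussian :: (real^'n) measure)) = 1" ..
qed

lemma space_std_gaussian [simp]: "space std_gaussian = UNIV"
  and sets_std_gaussian [simp, measurable_cong]: "sets std_gaussian = sets borel"
  by (simp_all add: std_gaussian_def)

lemma AE_std_gaussian:
  assumes "AE z in lborel. P z"
  shows "AE z in std_gaussian. P z"
  using assms unfolding std_gaussian_def by (subst AE_density) auto

lemma measurable_affine_map [measurable]: "(\<lambda>z. \<mu> + (B :: real^'n^'n) *v z) \<in> borel_measurable borel"
  by (intro borel_measurable_continuous_onI continuous_intros
      linear_continuous_on linear_conv_bounded_linear[THEN iffD1] matrix_vector_mul_linear)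

lemma prob_space_gaussian: "prob_space (gaussian \<mu> A)"
  unfolding gaussian_def by (intro prob_space.prob_space_distr prob_space_std_gaussian) simp

text \<open>Places all the laws on one probability space, so that convergence can be studied for a
  fixed standard normal outcome \<open>z\<close>.\<close>

lemma measure_gaussian:
  assumes "S \<in> sets borel"
  shows "measure (gaussian \<mu> A) S =
    measure std_gaussian {z. \<mu> + (SOME B :: real^'n^'n. B ** transpose B = A) *v z \<in> S}"
  unfolding gaussian_def using assms by (subst measure_distr) (auto simp: vimage_def)

text \<open>Dominated convergence for indicators.\<close>

lemma (in prob_space) tendsto_prob_eventually:
  assumes "\<And>k. A k \<in> events" "AE z in M. \<forall>\<^sub>F k in sequentially. z \<in> A k"
  shows "(\<lambda>k. prob (A k)) \<longlonglongrightarrow> 1"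
proof -
  have "(\<lambda>k. \<integral>z. indicator (A k) z \<partial>M) \<longlonglongrightarrow> (\<integral>z. (1::real) \<partial>M)"
  proof (rule integral_dominated_convergence[where w="\<lambda>_. 1"])
    show "AE z in M. (\<lambda>k. indicator (A k) z :: real) \<longlonglongrightarrow> 1"
      using assms(2)
    proof eventually_elim
      case (elim z)
      then have "\<forall>\<^sub>F k in sequentially. indicator (A k) z = (1::real)"
        by eventually_elim simp
      then show ?case by (rule tendsto_eventually)
    qed
    show "(\<lambda>z. indicator (A k) z :: real) \<in> borel_measurable M" for k
      using assms(1) by simp
  qed (auto simp: indicator_def)
  then show ?thesis using assms(1) prob_space by (simp add: measure_def)
qed


section \<open>The test statistic\<close>

context
  fixes X :: "real^'k^'n::{finite,linorder}" and R :: "real^'k^'q" and r :: "real^'q"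
  assumes n: "2 \<le> CARD('n)" and X: "rank X = CARD('k)" and R: "rank R = CARD('q)"
begin

abbreviation (input) T_AM :: "real^'n::{finite,linorder} \<Rightarrow> real" where
  "T_AM \<equiv> F_type_statistic R r (beta_hat X) (Omega_AM X R) (N_AM X)"

lemma F_type_statistic_AM_not_in:
  assumes "y \<notin> N_AM X"
  shows "T_AM y = (R *v beta_hat X y - r) \<bullet> (matrix_inv (Omega_AM X R y) *v (R *v beta_hat X y - r))"
proof -
  have "det (Omega_AM X R y) \<noteq> 0"
    using invertible_Omega_AM[OF X R assms] by (simp add: invertible_det_nz)
  then show ?thesis using assms by (simp add: F_type_statistic_def N_star_def)
qed

text \<open>It suffices to make the numerator large in one direction \<open>l\<close>, whatever
  happens in the others.\<close>

lemma F_type_statistic_AM_ge: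
  assumes "y \<notin> N_AM X" "l \<noteq> 0"
  shows "(l \<bullet> (R *v beta_hat X y - r))\<^sup>2 / (omega_AM X y * (l \<bullet> (restriction_cov X R *v l))) \<le> T_AM y"
proof -
  have "transpose (Omega_AM X R y) = Omega_AM X R y"
    using transpose_restriction_cov[OF X, of R] by (simp add: Omega_AM_eq transpose_scaleR)
  from inner_matrix_inv_ge[OF this Omega_AM_definite[OF X R assms(1)] assms(2), of "R *v beta_hat X y - r"]
  show ?thesis
    unfolding F_type_statistic_AM_not_in[OF assms(1)]
    by (simp add: Omega_AM_eq scaleR_matrix_vector_assoc[symmetric])
qed

text \<open>Outside \<open>N_AM\<close> the inverse of \<open>Omega_AM\<close> is a fixed matrix
  divided by \<open>omega_AM\<close>, which makes the statistic a continuous quotient there.\<close>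

lemma borel_measurable_F_type_statistic_AM: "T_AM \<in> borel_measurable borel"
proof -
  define V where "V = matrix_inv (restriction_cov X R)"
  define w where "w y = R *v beta_hat X y - r" for y
  have "invertible (restriction_cov X R)"
    by (intro invertible_if_definite restriction_cov_pos[OF X R])
  then have S: "restriction_cov X R ** V = mat 1" "V ** restriction_cov X R = mat 1"
    unfolding V_def by (simp_all add: matrix_inv_right matrix_inv_left)
  have "matrix_inv (Omega_AM X R y) = (1 / omega_AM X y) *\<^sub>R V" if "y \<notin> N_AM X" for y
    using omega_AM_pos[OF that] S
    by (intro matrix_inv_eqI) (simp_all add: Omega_AM_eq scalar_matrix_assoc[symmetric] matrix_scalar_ac)
  then have T: "T_AM y = (if y \<in> N_AM X then 0 else w y \<bullet> (V *v w y) / omega_AM X y)" for y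
    using F_type_statistic_AM_not_in[of y]
    by (auto simp: F_type_statistic_def N_star_def w_def scaleR_matrix_vector_assoc[symmetric])
  have lin: "continuous_on S' (\<lambda>y. M *v g y)" if "continuous_on S' g"
    for S' and M :: "real^'b^'a" and g :: "real^'n::{finite,linorder} \<Rightarrow> real^'b"
    using continuous_on_compose2[OF linear_continuous_on[OF matrix_vector_mul_bounded_linear] that]
    by blast
  have w: "continuous_on S' w" for S'
    unfolding w_def using linear_beta_hat[of X]
    by (intro continuous_intros lin linear_continuous_on) (simp add: linear_conv_bounded_linear)
  have "continuous_on (- N_AM X) (\<lambda>y. w y \<bullet> (V *v w y) / omega_AM X y)"
    using omega_AM_pos by (intro continuous_intros lin w continuous_on_omega_AM n) force
  then have "(\<lambda>y. if y \<in> N_AM X then 0 else w y \<bullet> (V *v w y) / omega_AM X y) \<in> borel_measurable borel"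
    by (intro borel_measurable_continuous_on_if borel_closed closed_N_AM continuous_on_const)
  then show ?thesis by (simp add: T[abs_def])
qed

end

text \<open>The diagonal of \<open>C ** transpose C\<close> holds the squared row norms; so square
  roots of convergent covariance matrices stay bounded.\<close>

lemma norm_matrix_le:
  fixes C :: "real^'n^'n"
  shows "norm C \<le> (\<Sum>i\<in>UNIV. sqrt ((C ** transpose C) $ i $ i))"
proof -
  have "norm (C $ i) = sqrt ((C ** transpose C) $ i $ i)" for i
    by (simp add: norm_eq_sqrt_inner inner_vec_def matrix_matrix_mult_def transpose_def)
  then show ?thesis
    unfolding norm_vec_def[of C] by (metis (mono_tags, lifting) L2_set_le_sum norm_ge_zero sum.cong)
qed

lemma tendsto_matrix_mult_transpose:
  fixes C :: "'a \<Rightarrow> real^'n^'n"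
  assumes "(C \<longlongrightarrow> L) F"
  shows "((\<lambda>k. C k ** transpose (C k)) \<longlongrightarrow> L ** transpose L) F"
  by (intro vec_tendstoI) (auto simp: matrix_matrix_mult_def transpose_def intro!: tendsto_intros assms)

lemma tendsto_matrix_vector_mult:
  fixes C :: "'a \<Rightarrow> real^'n^'m"
  assumes "(C \<longlongrightarrow> L) F"
  shows "((\<lambda>k. C k *v z) \<longlongrightarrow> L *v z) F"
  by (intro vec_tendstoI) (auto simp: matrix_vector_mult_def intro!: tendsto_intros assms)

text \<open>Reads a moment of \<open>g\<close> as its inner product with a trend column. Ranks start
  at 1 and exponents at 0, hence the shift.\<close>

lemma sum_monomials_eq_fitted:
  fixes X :: "real^'k::{finite,linorder}^'n::{finite,linorder}" and g :: "real^'n::{finite,linorder}"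
  assumes "\<forall>i j. pos j \<le> kF \<longrightarrow> X $ i $ j = real (pos i) ^ (pos j - 1)" "pos j \<le> kF"
  shows "(\<Sum>t\<in>UNIV. g $ t * real (pos t) ^ (pos j - 1)) = g \<bullet> (X *v axis j 1)"
  using assms by (simp add: inner_vec_def matrix_vector_mult_basis column_def)

text \<open>
  After division by the scale \<open>s\<close> the residuals have a nondegenerate Gaussian limit along a
  subsequence, while the numerator of the statistic diverges in one direction of \<open>R\<close>.
\<close>

lemma rejection_probability_tends_to_1:
  fixes X :: "real^'k::{finite,linorder}^'n::{finite,linorder}" and R :: "real^'k::{finite,linorder}^'q"
    and r :: "real^'q" and \<mu>0 :: "real^'n::{finite,linorder}"
    and f :: "nat \<Rightarrow> real \<Rightarrow> real" and c :: "nat \<Rightarrow> real"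
  assumes n: "2 \<le> CARD('n)" and X: "rank X = CARD('k)" and R: "rank R = CARD('q)"
    and N: "N_AM X \<noteq> UNIV" and \<mu>0: "\<mu>0 \<in> M0 X R r" and \<sigma>2: "\<sigma>2 > 0" and l: "l \<noteq> 0"
    and h: "\<And>y. h \<bullet> y = l \<bullet> (R *v beta_hat X y)"
    and c: "\<And>m. c m > 0"
    and sym: "\<And>m. transpose (Sigma_mat (f m) :: real^'n::{finite,linorder}^'n::{finite,linorder}) = Sigma_mat (f m)"
    and psd: "\<And>m (z :: real^'n::{finite,linorder}). z \<bullet> (Sigma_mat (f m) *v z) \<ge> 0"
    and resid: "(\<lambda>m. (1 / c m) *\<^sub>R (residual_maker X ** Sigma_mat (f m) ** transpose (residual_maker X)))
      \<longlonglongrightarrow> residual_maker X ** transpose (residual_maker X)"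
    and diverge: "filterlim (\<lambda>m. (h \<bullet> (Sigma_mat (f m) *v h)) / c m) at_top sequentially"
  obtains \<phi> :: "nat \<Rightarrow> nat" where
    "(\<lambda>k. measure (gaussian \<mu>0 (\<sigma>2 *\<^sub>R Sigma_mat (f (\<phi> k))))
      {y. F_type_statistic R r (beta_hat X) (Omega_AM X R) (N_AM X) y \<ge> C}) \<longlonglongrightarrow> 1"
proof -
  let ?T = "F_type_statistic R r (beta_hat X) (Omega_AM X R) (N_AM X)"
  define Q where "Q = residual_maker X"
  have Q: "Q ** transpose Q = Q"
    using residual_maker_idem[OF X] transpose_residual_maker[OF X] by (simp add: Q_def)
  \<comment> \<open>Literally the choice made in \<open>gaussian\<close>. Nothing but its defining
    equation is known, so \<open>B\<close> need not converge even when the covariances do; this is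
    why subsequences are needed.\<close>
  define B :: "nat \<Rightarrow> real^'n::{finite,linorder}^'n::{finite,linorder}" where "B m = (SOME B. B ** transpose B = \<sigma>2 *\<^sub>R Sigma_mat (f m))" for m
  have B: "B m ** transpose (B m) = \<sigma>2 *\<^sub>R Sigma_mat (f m)" for m
    unfolding B_def
  proof (rule someI_ex, rule ex_square_root_psd)
    show "transpose (\<sigma>2 *\<^sub>R Sigma_mat (f m) :: real^'n::{finite,linorder}^'n::{finite,linorder}) = \<sigma>2 *\<^sub>R Sigma_mat (f m)"
      using sym[of m] by (simp add: transpose_scaleR)
    show "z \<bullet> ((\<sigma>2 *\<^sub>R Sigma_mat (f m)) *v z) \<ge> 0" for z :: "real^'n::{finite,linorder}"
      using psd[of z m] \<sigma>2 by (simp add: scaleR_matrix_vector_assoc[symmetric])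
  qed
  \<comment> \<open>The standard deviation scale of the residuals, by the assumption on the
    covariance limit.\<close>
  define s where "s m = sqrt (\<sigma>2 * c m)" for m
  have s: "s m > 0" "(s m)\<^sup>2 = \<sigma>2 * c m" for m
    using \<sigma>2 c[of m] by (simp_all add: s_def)
  \<comment> \<open>\<open>L m *v z\<close> is the magnified residual and
    \<open>b m \<bullet> z\<close> the numerator in direction \<open>l\<close> on the same scale.
    The latter is split into its diverging length and its direction \<open>e m\<close>, which stays
    in a compact set.\<close>
  define L where "L m = (1 / s m) *\<^sub>R (Q ** B m)" for m
  define b where "b m = (1 / s m) *\<^sub>R (transpose (B m) *v h)" for m
  define e where "e m = (1 / norm (b m)) *\<^sub>R b m" for m
  have LL: "L m ** transpose (L m) = (1 / c m) *\<^sub>R (Q ** Sigma_mat (f m) ** transpose Q)" for m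
  proof -
    have "L m ** transpose (L m) = (1 / (s m)\<^sup>2) *\<^sub>R (Q ** (B m ** transpose (B m)) ** transpose Q)"
      by (simp add: L_def transpose_scaleR matrix_transpose_mul scalar_matrix_assoc[symmetric]
          matrix_scalar_ac matrix_mul_assoc power2_eq_square)
    then show ?thesis
      using \<sigma>2 c[of m] by (simp add: B s scalar_matrix_assoc[symmetric] matrix_scalar_ac)
  qed
  then have L_lim: "(\<lambda>m. L m ** transpose (L m)) \<longlonglongrightarrow> Q"
    using resid Q by (simp add: Q_def)
  have "(norm (b m))\<^sup>2 = (h \<bullet> (Sigma_mat (f m) *v h)) / c m" for m
  proof -
    have "(norm (b m))\<^sup>2 = (1 / (s m)\<^sup>2) * ((transpose (B m) *v h) \<bullet> (transpose (B m) *v h))"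
      unfolding power2_norm_eq_inner b_def by (simp add: power2_eq_square)
    also have "(transpose (B m) *v h) \<bullet> (transpose (B m) *v h) = h \<bullet> ((B m ** transpose (B m)) *v h)"
      by (simp add: inner_matrix_vector_transpose[of h "B m"] flip: matrix_vector_mul_assoc)
    finally show ?thesis
      using \<sigma>2 c[of m] by (simp add: B s scaleR_matrix_vector_assoc[symmetric])
  qed
  then have b_lim: "filterlim (\<lambda>m. (norm (b m))\<^sup>2) at_top sequentially"
    using diverge by simp

  have "bounded (range L)"
  proof -
    have "(\<lambda>m. \<Sum>i\<in>UNIV. sqrt ((L m ** transpose (L m)) $ i $ i)) \<longlonglongrightarrow> (\<Sum>i\<in>UNIV. sqrt (Q $ i $ i))"
      by (intro tendsto_intros L_lim)
    then have "bounded (range (\<lambda>m. \<Sum>i\<in>UNIV. sqrt ((L m ** transpose (L m)) $ i $ i)))"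
      by (rule convergent_imp_bounded)
    then obtain K where "\<And>m. (\<Sum>i\<in>UNIV. sqrt ((L m ** transpose (L m)) $ i $ i)) \<le> K"
      by (auto simp: bounded_real abs_le_iff)
    then have "norm (L m) \<le> K" for m
      using norm_matrix_le[of "L m"] order_trans by blast
    then show ?thesis by (auto simp: bounded_iff)
  qed
  moreover have "norm (e m) \<le> 1" for m by (simp add: e_def)
  then have "bounded (range e)" by (auto simp: bounded_iff)
  \<comment> \<open>The pair is treated jointly so that one subsequence serves both limits.\<close>
  ultimately have "bounded (range L \<times> range e)" by (rule bounded_Times)
  then have "bounded (range (\<lambda>m. (L m, e m)))" by (rule bounded_subset) auto
  from bounded_imp_convergent_subsequence[OF this]
  obtain p \<phi> where \<phi>: "strict_mono (\<phi> :: nat \<Rightarrow> nat)" and p: "((\<lambda>m. (L m, e m)) \<circ> \<phi>) \<longlonglongrightarrow> p"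
    by blast
  define L0 e0 where "L0 = fst p" and "e0 = snd p"
  have L0: "(\<lambda>k. L (\<phi> k)) \<longlonglongrightarrow> L0" and e0: "(\<lambda>k. e (\<phi> k)) \<longlonglongrightarrow> e0"
    using tendsto_fst[OF p] tendsto_snd[OF p] by (simp_all add: o_def L0_def e0_def)
  have \<phi>_lim: "filterlim \<phi> sequentially sequentially"
    using \<phi> by (rule filterlim_subseq)
  have b_lim': "filterlim (\<lambda>k. (norm (b (\<phi> k)))\<^sup>2) at_top sequentially"
    using b_lim \<phi>_lim by (rule filterlim_compose)
  have L0Q: "L0 ** transpose L0 = Q"
    using LIMSEQ_unique[OF tendsto_matrix_mult_transpose[OF L0]
        filterlim_compose[OF L_lim \<phi>_lim]] .
  have "norm e0 = 1"
  proof -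
    have "\<forall>\<^sub>F k in sequentially. norm (e (\<phi> k)) = 1"
      using filterlim_at_top_dense[THEN iffD1, OF b_lim', rule_format, of 0]
      by eventually_elim (auto simp: e_def)
    then have "(\<lambda>k. norm (e (\<phi> k))) \<longlonglongrightarrow> 1" by (rule tendsto_eventually)
    then show ?thesis using tendsto_norm[OF e0] LIMSEQ_unique by blast
  qed
  then have "e0 \<noteq> 0" by auto

  obtain \<beta>0 where \<beta>0: "\<mu>0 = X *v \<beta>0" "R *v \<beta>0 = r" using \<mu>0 by (auto simp: M0_def)
  define \<kappa> where "\<kappa> = l \<bullet> (restriction_cov X R *v l)"
  have \<kappa>: "\<kappa> > 0" unfolding \<kappa>_def by (rule restriction_cov_pos[OF X R l])
  have lower: "(norm (b m))\<^sup>2 * (e m \<bullet> z)\<^sup>2 / (omega_AM X (L m *v z) * \<kappa>) \<le> ?T (\<mu>0 + B m *v z)"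
    if notin: "L m *v z \<notin> N_AM X" and "b m \<noteq> 0" for m z
  proof -
    define y where "y = \<mu>0 + B m *v z"
    have "s m *\<^sub>R (L m *v z) = u_hat X (B m *v z)"
      using s(1)[of m] by (simp add: L_def Q_def u_hat_eq matrix_vector_mul_assoc
          scaleR_matrix_vector_assoc[symmetric])
    \<comment> \<open>Everything but the residual lies in the column space of \<open>X\<close>,
      where equivariance discards it.\<close>
    then have y: "y = s m *\<^sub>R (L m *v z) + X *v (\<beta>0 + beta_hat X (B m *v z))"
      by (simp add: y_def \<beta>0 u_hat_def matrix_vector_right_distrib)
    have "s m \<noteq> 0" using s(1)[of m] by simp
    then have "y \<notin> N_AM X" and \<omega>: "omega_AM X y = (s m)\<^sup>2 * omega_AM X (L m *v z)"
      unfolding y using notin not_in_N_AM_affine[OF X] omega_AM_affine[OF X] by auto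
    have "R *v beta_hat X y - r = R *v beta_hat X (B m *v z)"
      using linear_beta_hat[of X] X \<beta>0
      by (simp add: y_def linear_add matrix_vector_right_distrib)
    then have "l \<bullet> (R *v beta_hat X y - r) = h \<bullet> (B m *v z)" by (simp add: h)
    also have "\<dots> = s m * (norm (b m) * (e m \<bullet> z))"
      using s(1)[of m] \<open>b m \<noteq> 0\<close> by (simp add: inner_matrix_vector_transpose[of h] e_def b_def)
    finally have num: "l \<bullet> (R *v beta_hat X y - r) = s m * (norm (b m) * (e m \<bullet> z))" .
    show ?thesis
      using F_type_statistic_AM_ge[OF n X R \<open>y \<notin> N_AM X\<close> l, of r] s(1)[of m]
      unfolding num \<omega> \<kappa>_def[symmetric] y_def[symmetric] by (simp add: power_mult_distrib mult.assoc)
  qed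

  have AE1: "AE z in lborel. L0 *v z \<notin> N_AM X"
  proof -
    obtain y0 where y0: "y0 \<notin> N_AM X" using N by blast
    \<comment> \<open>A preimage of the residual of \<open>y0\<close> under \<open>L0\<close>. Since
      \<open>y0\<close> and its residual differ by a fitted vector, the residual lies outside
      \<open>N_AM\<close> too, and the composed polynomial is not identically 0.\<close>
    have "L0 *v (transpose L0 *v y0) = u_hat X y0"
      by (simp add: matrix_vector_mul_assoc L0Q u_hat_eq Q_def)
    also have "\<dots> = 1 *\<^sub>R y0 + X *v (- beta_hat X y0)"
      by (simp add: u_hat_def linear_neg)
    also have "\<dots> \<notin> N_AM X" using not_in_N_AM_affine[OF X, of 1] y0 by simp
    finally have "AM_poly X (L0 *v (transpose L0 *v y0)) \<noteq> 0" by (simp add: N_AM_eq)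
    moreover have "real_polynomial_function (AM_poly X \<circ> (\<lambda>z. L0 *v z))"
      by (intro real_polynomial_function_compose real_polynomial_function_AM_poly
          polynomial_function_bounded_linear matrix_vector_mul_bounded_linear)
    ultimately have "AE z in lborel. (AM_poly X \<circ> (\<lambda>z. L0 *v z)) z \<noteq> 0"
      by (intro AE_real_polynomial_function_nonzero[where q="AM_poly X \<circ> (\<lambda>z. L0 *v z)"
            and ?y0.0="transpose L0 *v y0"]) simp_all
    then show ?thesis by (simp add: N_AM_eq)
  qed
  have AE2: "AE z in lborel. e0 \<bullet> z \<noteq> 0"
    using \<open>e0 \<noteq> 0\<close>
    by (intro AE_real_polynomial_function_nonzero[where ?y0.0=e0] real_polynomial_function.intros(1)
        bounded_linear_inner_right) auto

  define A where "A k = {z. C \<le> ?T (\<mu>0 + B (\<phi> k) *v z)}" for k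
  have meas: "{y. C \<le> ?T y} \<in> sets borel"
    using borel_measurable_F_type_statistic_AM[OF n X R, of r] by measurable
  have "A k \<in> sets std_gaussian" for k
    using measurable_affine_map[of \<mu>0 "B (\<phi> k)"] borel_measurable_F_type_statistic_AM[OF n X R, of r]
    unfolding A_def by simp
  moreover have "AE z in std_gaussian. \<forall>\<^sub>F k in sequentially. z \<in> A k"
    using AE_std_gaussian[OF AE1] AE_std_gaussian[OF AE2]
  proof eventually_elim
    case (elim z)
    define a \<omega> where "a = (e0 \<bullet> z)\<^sup>2" and "\<omega> = omega_AM X (L0 *v z)"
    have a: "a > 0" and \<omega>: "\<omega> > 0"
      using elim omega_AM_pos by (auto simp: a_def \<omega>_def)
    have op: "open (- N_AM X)" using closed_N_AM[of X] by (rule open_Compl)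
    have Lz: "(\<lambda>k. L (\<phi> k) *v z) \<longlonglongrightarrow> L0 *v z"
      by (rule tendsto_matrix_vector_mult[OF L0])
    have "isCont (omega_AM X) (L0 *v z)"
      using continuous_on_omega_AM[OF n, of X] op elim by (simp add: continuous_on_eq_continuous_at)
    then have "(\<lambda>k. omega_AM X (L (\<phi> k) *v z)) \<longlonglongrightarrow> \<omega>"
      unfolding \<omega>_def using Lz by (rule isCont_tendsto_compose)
    then have E1: "\<forall>\<^sub>F k in sequentially. omega_AM X (L (\<phi> k) *v z) < 2 * \<omega>"
      using \<omega> by (intro order_tendstoD(2)) auto
    have E2: "\<forall>\<^sub>F k in sequentially. L (\<phi> k) *v z \<in> - N_AM X"
      using topological_tendstoD[OF Lz op] elim by simp
    have "(\<lambda>k. (e (\<phi> k) \<bullet> z)\<^sup>2) \<longlonglongrightarrow> a"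
      unfolding a_def by (intro tendsto_intros e0)
    then have E3: "\<forall>\<^sub>F k in sequentially. a / 2 < (e (\<phi> k) \<bullet> z)\<^sup>2"
      using a by (intro order_tendstoD(1)) auto
    \<comment> \<open>The threshold results from replacing the squared projection by
      \<open>a / 2\<close> and the variance estimate by \<open>2 * \<omega>\<close>; the maximum
      with 0 ensures \<open>b (\<phi> k) \<noteq> 0\<close> also for negative
      \<open>C\<close>.\<close>
    have E4: "\<forall>\<^sub>F k in sequentially. max 0 (C * (4 * \<omega> * \<kappa> / a)) < (norm (b (\<phi> k)))\<^sup>2"
      using b_lim' unfolding filterlim_at_top_dense by blast
    show ?case using E1 E2 E3 E4
    proof eventually_elim
      case (elim k)
      define w where "w = omega_AM X (L (\<phi> k) *v z)"
      have notin: "L (\<phi> k) *v z \<notin> N_AM X" using elim by simp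
      have w: "0 < w" "w < 2 * \<omega>" using elim omega_AM_pos[OF notin] by (auto simp: w_def)
      have "b (\<phi> k) \<noteq> 0" using elim by auto
      have "C * (4 * \<omega> * \<kappa> / a) \<le> (norm (b (\<phi> k)))\<^sup>2" using elim by simp
      then have "C \<le> (norm (b (\<phi> k)))\<^sup>2 * (a / 2) / ((2 * \<omega>) * \<kappa>)"
        using a \<omega> \<kappa> by (simp add: field_simps)
      also have "\<dots> \<le> (norm (b (\<phi> k)))\<^sup>2 * (e (\<phi> k) \<bullet> z)\<^sup>2 / (w * \<kappa>)"
        using elim w \<kappa> a by (intro frac_le mult_left_mono mult_right_mono mult_nonneg_nonneg mult_pos_pos) auto
      also have "\<dots> \<le> ?T (\<mu>0 + B (\<phi> k) *v z)"
        unfolding w_def by (rule lower[OF notin \<open>b (\<phi> k) \<noteq> 0\<close>])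
      finally show ?case by (simp add: A_def)
    qed
  qed
  ultimately have "(\<lambda>k. measure std_gaussian (A k)) \<longlonglongrightarrow> 1"
    by (rule prob_space.tendsto_prob_eventually[OF prob_space_std_gaussian])
  then have "(\<lambda>k. measure (gaussian \<mu>0 (\<sigma>2 *\<^sub>R Sigma_mat (f (\<phi> k)))) {y. C \<le> ?T y}) \<longlonglongrightarrow> 1"
    unfolding measure_gaussian[OF meas] A_def B_def by simp
  then show thesis by (rule that)
qed


theorem corollary5p6:
  fixes X :: "real^('k::{finite,linorder})^('n::{finite,linorder})"
    and R :: "real^('k::{finite,linorder})^('q::finite)"
    and r :: "real^'q"
    and kF :: nat
    and \<FF> :: "(real \<Rightarrow> real) set"
  assumes "CARD('k) < CARD('n)"
    and "rank X = CARD('k)"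
    and "rank R = CARD('q)"
    and "\<FF> \<subseteq> spec_all"
    and "spec_AR2_ext \<subseteq> \<FF>"
    and "1 \<le> kF" and "kF \<le> CARD('k)"
    and "\<forall>i j. pos j \<le> kF \<longrightarrow> X $ i $ j = real (pos i) ^ (pos j - 1)"
    and "\<exists>j. pos j \<le> kF \<and> column j R \<noteq> 0"
    and "N_AM X \<noteq> UNIV"
  shows "(\<forall>y. y \<notin> N_AM X \<longrightarrow> AM_well_defined X y) \<and>
    estimator_conditions X (beta_hat X) (Omega_AM X R) (N_AM X) \<and>
    (\<forall>C::real. \<forall>\<mu>0\<in>M0 X R r. \<forall>\<sigma>2>0.
       (SUP f\<in>\<FF>. measure (gaussian \<mu>0 (\<sigma>2 *\<^sub>R Sigma_mat f))
          {y. F_type_statistic R r (beta_hat X) (Omega_AM X R) (N_AM X) y \<ge> C}) = 1)"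
proof (intro conjI allI ballI impI)
  have n: "2 \<le> CARD('n)"
  proof -
    have "0 < CARD('k)" by simp
    then show ?thesis using assms(1) by linarith
  qed
  show "AM_well_defined X y" if "y \<notin> N_AM X" for y
    using AM_well_defined_if_not_in_N_AM[OF n that] .
  show "estimator_conditions X (beta_hat X) (Omega_AM X R) (N_AM X)"
    by (rule estimator_conditions_AM[OF n assms(2,3,10)])
  fix C :: real and \<mu>0 \<sigma>2
  assume \<mu>0: "\<mu>0 \<in> M0 X R r" and \<sigma>2: "\<sigma>2 > (0::real)"
  let ?P = "\<lambda>f. measure (gaussian \<mu>0 (\<sigma>2 *\<^sub>R Sigma_mat f))
    {y. F_type_statistic R r (beta_hat X) (Omega_AM X R) (N_AM X) y \<ge> C}"

  \<comment> \<open>The least trend index with a nonzero column of \<open>R\<close> is taken, so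
    that all lower moments of \<open>h\<close> vanish.\<close>
  define cand where "cand p \<longleftrightarrow> (\<exists>j::'k. pos j = p \<and> p \<le> kF \<and> column j R \<noteq> 0)" for p
  have "\<exists>p. cand p" using assms(9) by (auto simp: cand_def)
  then obtain p where p: "cand p" and least: "\<And>p'. p' < p \<Longrightarrow> \<not> cand p'"
    using exists_least_iff[of cand] by blast
  then obtain i :: 'k where i: "pos i \<le> kF" "column i R \<noteq> 0" "pos i = p"
    by (auto simp: cand_def)
  \<comment> \<open>With this direction the first nonvanishing moment of \<open>h\<close> is the
    squared length of the column.\<close>
  define l where "l = column i R"
  have zero: "column j R = 0" if "pos j < pos i" for j
    using least[of "pos j"] that i by (auto simp: cand_def)

  define H where "H = R ** (matrix_inv (gram X) ** transpose X)"
  define h where "h = transpose H *v l"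
  have h: "h \<bullet> y = l \<bullet> (R *v beta_hat X y)" for y
  proof -
    have "R *v beta_hat X y = H *v y"
      by (simp add: H_def beta_hat_eq matrix_vector_mul_assoc matrix_mul_assoc)
    then show ?thesis by (simp add: h_def inner_matrix_vector_transpose[of l])
  qed
  have mom: "(\<Sum>t\<in>UNIV. h $ t * real (pos t) ^ (pos j - 1)) = l \<bullet> column j R" if "pos j \<le> kF" for j
    unfolding sum_monomials_eq_fitted[OF assms(8) that] h beta_hat_fitted[OF assms(2)]
    by (simp add: matrix_vector_mult_basis)
  have ex: "\<exists>j::'k. pos j = Suc q" if "q < kF" for q
    using that assms(7) by (intro ex_pos) auto
  have Q0: "(\<Sum>t\<in>UNIV. residual_maker X $ s $ t * real (pos t) ^ q) = 0" if q: "q < kF" for s q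
  proof -
    obtain j :: 'k where j: "pos j = Suc q" using ex[OF q] by blast
    have "(\<Sum>t\<in>UNIV. residual_maker X $ s $ t * real (pos t) ^ (pos j - 1)) =
        residual_maker X $ s \<bullet> (X *v axis j 1)"
      using q j by (intro sum_monomials_eq_fitted[OF assms(8)]) simp
    also have "\<dots> = (residual_maker X *v (X *v axis j 1)) $ s"
      by (simp add: matrix_vector_mul_component)
    finally show ?thesis using j by (simp add: residual_maker_fitted[OF assms(2)])
  qed
  have h0: "(\<Sum>t\<in>UNIV. h $ t * real (pos t) ^ q) = 0" if q: "q < pos i - 1" for q
  proof -
    have "q < kF" using q i(1) by linarith
    then obtain j :: 'k where j: "pos j = Suc q" using ex by blast
    show ?thesis using mom[of j] zero[of j] j q i(1) by simp
  qed
  have h1: "(\<Sum>t\<in>UNIV. h $ t * real (pos t) ^ (pos i - 1)) \<noteq> 0"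
    using mom[OF i(1)] i(2) by (simp add: l_def)
  have "pos i - 1 < kF" using i(1) pos_ge_1[of i] by simp
  show "(SUP g\<in>\<FF>. ?P g) = 1"
  proof (rule ex_concentrating_spec_AR2_ext[OF Q0 h0 h1 \<open>pos i - 1 < kF\<close>])
    fix f :: "nat \<Rightarrow> real \<Rightarrow> real" and c :: "nat \<Rightarrow> real"
    assume f: "\<And>m. f m \<in> spec_AR2_ext"
      and rest: "\<And>m. c m > 0"
      "\<And>m. transpose (Sigma_mat (f m) :: real^'n::{finite,linorder}^'n::{finite,linorder}) = Sigma_mat (f m)"
      "\<And>m (z :: real^'n::{finite,linorder}). z \<bullet> (Sigma_mat (f m) *v z) \<ge> 0"
      "(\<lambda>m. (1 / c m) *\<^sub>R (residual_maker X ** Sigma_mat (f m) ** transpose (residual_maker X)))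
        \<longlonglongrightarrow> residual_maker X ** transpose (residual_maker X)"
      "filterlim (\<lambda>m. (h \<bullet> (Sigma_mat (f m) *v h)) / c m) at_top sequentially"
    have "l \<noteq> 0" using i(2) by (simp add: l_def)
    obtain \<phi> where lim: "(\<lambda>k. ?P (f (\<phi> k))) \<longlonglongrightarrow> 1"
      using rejection_probability_tends_to_1[OF n assms(2,3,10) \<mu>0 \<sigma>2 \<open>l \<noteq> 0\<close> h rest, of C] by blast
    have le1: "?P g \<le> 1" for g
      by (rule prob_space.prob_le_1[OF prob_space_gaussian])
    have mem: "f m \<in> \<FF>" for m using f assms(5) by blast
    have "?P (f (\<phi> k)) \<le> (SUP g\<in>\<FF>. ?P g)" for k
      using mem le1 by (intro cSUP_upper bdd_aboveI2)
    then have "1 \<le> (SUP g\<in>\<FF>. ?P g)"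
      using lim by (intro LIMSEQ_le_const2) auto
    moreover have "(SUP g\<in>\<FF>. ?P g) \<le> 1"
      using mem le1 by (intro cSUP_least) auto
    ultimately show "(SUP g\<in>\<FF>. ?P g) = 1" by (rule antisym[rotated])
  qed
qed


end
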